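(* Let $a,b,c,d\in\mathbb{R}$ satisfy (C0) together with (C1) or (C2), and let $\nu\in\{0,1\}$. Assume that either $\nu=1$, or $\nu=0$ and $\mathrm{order}(\sigma)>-2+\tfrac12\,\mathrm{order}(\varepsilon)$. Then for any initial data $(\eta_0,u_0)$ with $(\eta_0,Hu_0)=(\eta_0,w_0)\in (L^1(\mathbb{R})\cap L^2(\mathbb{R}))^2$, where $\widehat{Hu_0}(\xi)=\left(\frac{(1-a\xi^2)(1+d\xi^2)}{(1-c\xi^2)(1+b\xi^2)}\right)^{1/2}\widehat{u_0}(\xi)$, there exists a constant $C$ such that the solution $(\eta,u)$ of the linear system $$\eta_t+u_x+au_{xxx}-b\eta_{xxt}=\nu\eta_{xx},\qquad u_t+\eta_x+c\eta_{xxx}-du_{xxt}=u_{xx}$$ with initial data $(\eta_0,u_0)$ satisfies, for all $t>0$, $$\|(\eta(t),Hu(t))\|_{L^2(\mathbb{R})}=\|(\eta(t),w(t))\|_{L^2(\mathbb{R})}\le C\,t^{-1/4}.$$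
   Context: Conditions on the real constants: (C0) $a+b+c+d=\frac13$ and $c+d=\frac12(1-\theta^2)\ge 0$ for some $\theta\in[0,1]$; (C1) $b\ge0,\ d\ge0,\ a\le0,\ c\le0$; (C2) $b\ge0,\ d\ge0,\ a=c>0$. Put $\omega_1=\frac{1-a\xi^2}{1+b\xi^2}$, $\omega_2=\frac{1-c\xi^2}{1+d\xi^2}$, $\sigma=(\omega_1\omega_2)^{1/2}$, $\widehat H=(\omega_1/\omega_2)^{1/2}$ (with $0/0=1$), $\alpha=\frac{\xi^2}{1+b\xi^2}$, $\varepsilon=\frac{\xi^2}{1+d\xi^2}$ (under (C1) or (C2) one has $\omega_1\omega_2\ge0$). $H$ is the Fourier multiplier operator with symbol $\widehat H$, and $w=Hu$. The Fourier transform in $x$ is taken with kernel $e^{-ix\xi}$ (any fixed multiplicative normalization). The order of a nonnegative function $\kappa(\xi)$ is the number $m$ with $\kappa(\xi)\sim C|\xi|^m$ as $|\xi|\to\infty$ for some $C>0$. Writing $\{r\}=1$ if $r\ne0$ and $\{0\}=0$, one has $\mathrm{order}(\sigma)=\{a\}+\{c\}-\{b\}-\{d\}$ and $\mathrm{order}(\varepsilon)=2-2\{d\}$. In the variable $\widehat Y=(\widehat\eta,\widehat w)$, $\widehat w=\widehat H\widehat u$, the linear system reads $\widehat Y_t+A(\xi)\widehat Y=0$ with $A(\xi)=\begin{pmatrix}\nu\alpha & i\,\mathrm{sgn}(\omega_1)\xi\sigma\\ i\,\mathrm{sgn}(\omega_2)\xi\sigma&\varepsilon\end{pmatrix}$,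 and its solution is $\widehat Y(t,\xi)=e^{-tA(\xi)}\widehat Y_0(\xi)$. For a pair, $\|(f_1,f_2)\|_{L^2}=(\|f_1\|_{L^2}^2+\|f_2\|_{L^2}^2)^{1/2}$. *)

theory Defs
  imports "HOL-Analysis.Analysis" "HOL-Library.Landau_Symbols"
begin

definition square_integrable :: "(real \<Rightarrow> complex) \<Rightarrow> bool" where
  "square_integrable f \<longleftrightarrow>
     f \<in> borel_measurable lborel \<and> integrable lborel (\<lambda>x. (cmod (f x))\<^sup>2)"

definition L2_norm :: "(real \<Rightarrow> complex) \<Rightarrow> real" where
  "L2_norm f = sqrt (LINT x|lborel. (cmod (f x))\<^sup>2)"

definition L2_norm_pair :: "(real \<Rightarrow> complex) \<Rightarrow> (real \<Rightarrow> complex) \<Rightarrow> real" where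
  "L2_norm_pair f g = sqrt ((L2_norm f)\<^sup>2 + (L2_norm g)\<^sup>2)"

definition fourier :: "(real \<Rightarrow> complex) \<Rightarrow> real \<Rightarrow> complex" where
  "fourier f \<xi> = (LINT x|lborel. exp (- (\<i> * of_real (x * \<xi>))) * f x)"

text \<open>
  \<^term>\<open>has_fourier_L2 f g\<close> says that \<open>g\<close> is (a version of) the Fourier--Plancherel transform of
  the square integrable function \<open>f\<close>, i.e. the limit in the mean, as \<open>R \<longlonglongrightarrow> \<infinity>\<close>, of the integrals
  over \<open>[-R, R]\<close>. The truncations of \<open>f\<close> are in \<open>L\<^sup>1 \<inter> L\<^sup>2\<close>, so by Plancherel's theorem the
  function inside the norm is always square integrable.
\<close>

definition has_fourier_L2 :: "(real \<Rightarrow> complex) \<Rightarrow> (real \<Rightarrow> complex) \<Rightarrow> bool" where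
  "has_fourier_L2 f g \<longleftrightarrow> square_integrable f \<and> square_integrable g \<and>
     ((\<lambda>R. L2_norm (\<lambda>\<xi>. fourier (\<lambda>x. indicator {-R..R} x * f x) \<xi> - g \<xi>)) \<longlongrightarrow> 0) at_top"

definition omega1 :: "real \<Rightarrow> real \<Rightarrow> real \<Rightarrow> real" where
  "omega1 a b \<xi> = (1 - a * \<xi>\<^sup>2) / (1 + b * \<xi>\<^sup>2)"

definition omega2 :: "real \<Rightarrow> real \<Rightarrow> real \<Rightarrow> real" where
  "omega2 c d \<xi> = (1 - c * \<xi>\<^sup>2) / (1 + d * \<xi>\<^sup>2)"

definition sigma_symbol :: "real \<Rightarrow> real \<Rightarrow> real \<Rightarrow> real \<Rightarrow> real \<Rightarrow> real" where
  "sigma_symbol a b c d \<xi> = sqrt (omega1 a b \<xi> * omega2 c d \<xi>)"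

definition epsilon_symbol :: "real \<Rightarrow> real \<Rightarrow> real" where
  "epsilon_symbol d \<xi> = \<xi>\<^sup>2 / (1 + d * \<xi>\<^sup>2)"

text \<open>
  The first case is the convention \<open>0/0 = 1\<close>; under the hypotheses on the coefficients
  \<open>omega2\<close> vanishes only where \<open>omega1\<close> does.
\<close>

definition H_symbol :: "real \<Rightarrow> real \<Rightarrow> real \<Rightarrow> real \<Rightarrow> real \<Rightarrow> real" where
  "H_symbol a b c d \<xi> =
     (if omega1 a b \<xi> = 0 \<and> omega2 c d \<xi> = 0 then 1 else sqrt (omega1 a b \<xi> / omega2 c d \<xi>))"

definition has_growth_order :: "(real \<Rightarrow> real) \<Rightarrow> real \<Rightarrow> bool" where
  "has_growth_order \<kappa> m \<longleftrightarrow> (\<exists>C>0. \<kappa> \<sim>[at_infinity] (\<lambda>\<xi>. C * \<bar>\<xi>\<bar> powr m))"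

definition growth_order :: "(real \<Rightarrow> real) \<Rightarrow> real" where
  "growth_order \<kappa> = (THE m. has_growth_order \<kappa> m)"

definition cond_C0 :: "real \<Rightarrow> real \<Rightarrow> real \<Rightarrow> real \<Rightarrow> bool" where
  "cond_C0 a b c d \<longleftrightarrow> a + b + c + d = 1 / 3 \<and>
     (\<exists>\<theta>\<in>{0..1}. c + d = (1 - \<theta>\<^sup>2) / 2 \<and> c + d \<ge> 0)"

definition cond_C1 :: "real \<Rightarrow> real \<Rightarrow> real \<Rightarrow> real \<Rightarrow> bool" where
  "cond_C1 a b c d \<longleftrightarrow> b \<ge> 0 \<and> d \<ge> 0 \<and> a \<le> 0 \<and> c \<le> 0"

definition cond_C2 :: "real \<Rightarrow> real \<Rightarrow> real \<Rightarrow> real \<Rightarrow> bool" where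
  "cond_C2 a b c d \<longleftrightarrow> b \<ge> 0 \<and> d \<ge> 0 \<and> a = c \<and> c > 0"

text \<open>
  The velocity \<open>u\<close> need not be a function (\<open>1 / H_symbol\<close> may grow quadratically, so that \<open>u\<close> is
  only in a Sobolev space of negative order), but it is a tempered distribution whose Fourier
  transform is a function; \<open>u\<close> is represented by this transform, \<open>uh\<close>. The relation below
  says that the Fourier multiplier operator \<open>H\<close> maps \<open>u\<close> to the \<open>L\<^sup>2\<close> function \<open>w\<close>.
\<close>

definition H_maps :: "real \<Rightarrow> real \<Rightarrow> real \<Rightarrow> real \<Rightarrow> (real \<Rightarrow> complex) \<Rightarrow> (real \<Rightarrow> complex) \<Rightarrow> bool" where
  "H_maps a b c d uh w \<longleftrightarrow> has_fourier_L2 w (\<lambda>\<xi>. of_real (H_symbol a b c d \<xi>) * uh \<xi>)"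

text \<open>
  \<open>linear_solution \<nu> a b c d \<eta>\<^sub>0 uh\<^sub>0 \<eta> w uh\<close>: the pair \<open>(\<eta>, u)\<close>, with \<open>u(t)\<close> given by its
  Fourier transform \<open>uh t\<close> and \<open>w(t) = Hu(t)\<close>, solves for \<open>t \<ge> 0\<close> the system
    \<open>\<eta>\<^sub>t + u\<^sub>x + a u\<^sub>x\<^sub>x\<^sub>x - b \<eta>\<^sub>x\<^sub>x\<^sub>t = \<nu> \<eta>\<^sub>x\<^sub>x\<close>,  \<open>u\<^sub>t + \<eta>\<^sub>x + c \<eta>\<^sub>x\<^sub>x\<^sub>x - d u\<^sub>x\<^sub>x\<^sub>t = u\<^sub>x\<^sub>x\<close>
  with data \<open>(\<eta>\<^sub>0, u\<^sub>0)\<close>. The system is understood after Fourier transform in \<open>x\<close>, i.e. as an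
  ordinary differential equation in \<open>t\<close> for almost every frequency \<open>\<xi>\<close>, where each \<open>x\<close>-derivative
  becomes a factor \<open>\<i> \<xi>\<close>. Time is the first argument of \<open>\<eta>\<close>, \<open>w\<close>, \<open>uh\<close> and \<open>\<eta>h\<close>.
\<close>

definition linear_solution ::
  "real \<Rightarrow> real \<Rightarrow> real \<Rightarrow> real \<Rightarrow> real \<Rightarrow> (real \<Rightarrow> complex) \<Rightarrow> (real \<Rightarrow> complex) \<Rightarrow>
   (real \<Rightarrow> real \<Rightarrow> complex) \<Rightarrow> (real \<Rightarrow> real \<Rightarrow> complex) \<Rightarrow> (real \<Rightarrow> real \<Rightarrow> complex) \<Rightarrow> bool" where
  "linear_solution \<nu> a b c d \<eta>0 uh0 \<eta> w uh \<longleftrightarrow>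
     (\<exists>\<eta>h :: real \<Rightarrow> real \<Rightarrow> complex.
        (\<forall>t\<ge>0. has_fourier_L2 (\<eta> t) (\<eta>h t) \<and> H_maps a b c d (uh t) (w t)) \<and>
        (AE \<xi> in lborel.
           \<eta>h 0 \<xi> = fourier \<eta>0 \<xi> \<and> uh 0 \<xi> = uh0 \<xi> \<and>
           (\<forall>t\<ge>0. \<exists>\<eta>h' uh'.
              ((\<lambda>s. \<eta>h s \<xi>) has_vector_derivative \<eta>h') (at t within {0..}) \<and>
              ((\<lambda>s. uh s \<xi>) has_vector_derivative uh') (at t within {0..}) \<and>
              (let D = \<i> * of_real \<xi> in
                 \<eta>h' + D * uh t \<xi> + of_real a * D ^ 3 * uh t \<xi> - of_real b * D\<^sup>2 * \<eta>h'
                   = of_real \<nu> * D\<^sup>2 * \<eta>h t \<xi> \<and>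
                 uh' + D * \<eta>h t \<xi> + of_real c * D ^ 3 * \<eta>h t \<xi> - of_real d * D\<^sup>2 * uh'
                   = D\<^sup>2 * uh t \<xi>))))"

end

theory Submission
  imports Defs "HOL-Probability.Characteristic_Functions"
begin

text \<open>
  After Fourier transform in \<open>x\<close> the system becomes, at each frequency \<open>\<xi>\<close>, a pair of ordinary
  differential equations for \<open>y\<close> (the transform of \<open>\<eta>\<close>) and \<open>w\<close> (the transform of \<open>Hu\<close>): the two
  are coupled by a skew-adjoint term \<open>\<i> x\<close> with \<open>x\<^sup>2 = \<xi>\<^sup>2 \<sigma>\<^sup>2\<close>, and damped at the rates \<open>\<nu> \<alpha>\<close> and \<open>\<epsilon>\<close>.
  The multiplier \<open>H\<close> is chosen to make the coupling skew, so \<open>\<bar>y\<bar>\<^sup>2 + \<bar>w\<bar>\<^sup>2\<close> never increases.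

  If \<open>\<nu> = 1\<close>, both components are damped. If \<open>\<nu> = 0\<close>, only \<open>w\<close> is damped, and the coupling must
  carry the energy of \<open>y\<close> into \<open>w\<close>. A Lyapunov function with a small multiple of \<open>Im (y cnj w)\<close>
  added to the energy shows that the energy then decays at a rate of at least a multiple of
  \<open>min \<epsilon> (x\<^sup>2 / \<epsilon>)\<close> (\<open>damped_system_decay\<close>). Here \<open>x\<^sup>2 / \<epsilon> = (1 - a \<xi>\<^sup>2) (1 - c \<xi>\<^sup>2) / (1 + b \<xi>\<^sup>2)\<close>
  has the order \<open>2 + 2 order \<sigma> - order \<epsilon>\<close>, an even integer; the hypothesis on the orders says that
  it exceeds \<open>-2\<close>, so that the rate does not tend to zero at infinity. Hence the
  rate can degenerate only at \<open>\<xi> = 0\<close> and, when \<open>a = c > 0\<close>, at the zeros \<open>\<xi> = \<plusminus> 1 / sqrt a\<close> of \<open>\<sigma>\<close>,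
  and it is bounded below by a multiple of the squared distance to these points, capped at \<open>1\<close>
  (\<open>dissipation_rate_lower_bound\<close>).

  The data are in \<open>L\<^sup>1\<close>, so their transforms are bounded, and the frequencies near a degenerate point
  \<open>p\<close> contribute at most a multiple of the integral of \<open>exp (- k t (\<xi> - p)\<^sup>2)\<close>, of size \<open>t\<close> to the
  power \<open>-1/2\<close>. The other frequencies decay exponentially, with the \<open>L\<^sup>2\<close> norm of the data as
  constant (\<open>flat_distance_decay\<close>). By Plancherel's theorem this bounds the square of the norm of
  the solution, which gives the exponent \<open>-1/4\<close>.

  The argument rests on the Fourier transform in \<open>L\<^sup>2\<close>: it multiplies norms by \<open>sqrt (2 \<pi>)\<close>
  (\<open>Plancherel\<close>, \<open>has_fourier_L2_norm\<close>), which turns estimates at each frequency into estimates of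
  the solution, and it is onto (\<open>has_fourier_L2_surj\<close>), which turns the explicit solution of the
  transformed equations into functions of \<open>x\<close>.
\<close>

section \<open>The space of square integrable functions\<close>

lemma square_integrable_measurable [measurable_dest]:
  "square_integrable f \<Longrightarrow> f \<in> borel_measurable borel"
  by (simp add: square_integrable_def)

lemma borel_measurable_cnj [measurable (raw)]:
  "f \<in> borel_measurable M \<Longrightarrow> (\<lambda>x. cnj (f x)) \<in> borel_measurable M"
  by (rule borel_measurable_continuous_on[OF continuous_on_cnj]) auto

lemma square_integrable_mono:
  assumes "square_integrable f" "g \<in> borel_measurable borel"
    "\<And>x. cmod (g x) \<le> C * cmod (f x)"
  shows "square_integrable g"
proof -
  have [measurable]: "g \<in> borel_measurable lborel" using assms by simp
  have "integrable lborel (\<lambda>x. C\<^sup>2 * (cmod (f x))\<^sup>2)"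
    using assms(1) by (simp add: square_integrable_def)
  then have "integrable lborel (\<lambda>x. (cmod (g x))\<^sup>2)"
  proof (rule Bochner_Integration.integrable_bound)
    show "AE x in lborel. norm ((cmod (g x))\<^sup>2) \<le> norm (C\<^sup>2 * (cmod (f x))\<^sup>2)"
    proof (rule AE_I2)
      fix x
      have "(cmod (g x))\<^sup>2 \<le> (C * cmod (f x))\<^sup>2"
        using assms(3)[of x] by (intro power_mono) auto
      then show "norm ((cmod (g x))\<^sup>2) \<le> norm (C\<^sup>2 * (cmod (f x))\<^sup>2)"
        by (simp add: power_mult_distrib)
    qed
  qed measurable
  then show ?thesis using assms by (simp add: square_integrable_def)
qed

lemma square_integrable_add:
  assumes "square_integrable f" "square_integrable g"
  shows "square_integrable (\<lambda>x. f x + g x)"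
proof -
  have [measurable]: "f \<in> borel_measurable lborel" "g \<in> borel_measurable lborel"
    using assms by (auto simp: square_integrable_def)
  have "integrable lborel (\<lambda>x. 2 * (cmod (f x))\<^sup>2 + 2 * (cmod (g x))\<^sup>2)"
    using assms by (simp add: square_integrable_def)
  then have "integrable lborel (\<lambda>x. (cmod (f x + g x))\<^sup>2)"
  proof (rule Bochner_Integration.integrable_bound)
    show "AE x in lborel. norm ((cmod (f x + g x))\<^sup>2)
            \<le> norm (2 * (cmod (f x))\<^sup>2 + 2 * (cmod (g x))\<^sup>2)"
    proof (rule AE_I2)
      fix x
      have "(cmod (f x + g x))\<^sup>2 \<le> (cmod (f x) + cmod (g x))\<^sup>2"
        by (intro power_mono norm_triangle_ineq) auto
      also have "\<dots> \<le> 2 * (cmod (f x))\<^sup>2 + 2 * (cmod (g x))\<^sup>2"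
        using sum_squares_bound[of "cmod (f x)" "cmod (g x)"]
        by (simp add: power2_sum)
      finally show "norm ((cmod (f x + g x))\<^sup>2) \<le> norm (2 * (cmod (f x))\<^sup>2 + 2 * (cmod (g x))\<^sup>2)"
        by simp
    qed
  qed measurable
  then show ?thesis by (simp add: square_integrable_def)
qed

lemma square_integrable_cmult:
  assumes "square_integrable f"
  shows "square_integrable (\<lambda>x. c * f x)"
  using assms by (auto simp: square_integrable_def norm_mult power_mult_distrib)

lemma square_integrable_diff:
  assumes "square_integrable f" "square_integrable g"
  shows "square_integrable (\<lambda>x. f x - g x)"
  using square_integrable_add[OF assms(1) square_integrable_cmult[OF assms(2), of "-1"]] by simp

lemma square_integrable_indicator:
  assumes "square_integrable f" "A \<in> sets borel"
  shows "square_integrable (\<lambda>x. indicator A x * f x)"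
  using assms by (intro square_integrable_mono[OF assms(1), where C = 1])
    (auto simp: norm_mult indicator_def square_integrable_measurable)

lemma L2_norm_nonneg [simp]: "0 \<le> L2_norm f"
  by (simp add: L2_norm_def)

lemma L2_norm_sq: "(L2_norm f)\<^sup>2 = (LINT x|lborel. (cmod (f x))\<^sup>2)"
  by (simp add: L2_norm_def)

lemma L2_norm_cmult: "L2_norm (\<lambda>x. c * f x) = cmod c * L2_norm f"
  by (simp add: L2_norm_def norm_mult power_mult_distrib real_sqrt_mult)

lemma L2_norm_minus_commute: "L2_norm (\<lambda>x. f x - g x) = L2_norm (\<lambda>x. g x - f x)"
  by (simp add: L2_norm_def norm_minus_commute)

lemma nn_integral_L2_norm:
  assumes "square_integrable f"
  shows "(\<integral>\<^sup>+x. ennreal ((cmod (f x))\<^sup>2) \<partial>lborel) = ennreal ((L2_norm f)\<^sup>2)"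
  unfolding L2_norm_sq using assms
  by (intro nn_integral_eq_integral) (auto simp: square_integrable_def)

lemma square_integrable_bounded_nn_integral:
  assumes "f \<in> borel_measurable borel" "0 \<le> C"
    "(\<integral>\<^sup>+x. ennreal ((cmod (f x))\<^sup>2) \<partial>lborel) \<le> ennreal (C\<^sup>2)"
  shows "square_integrable f" "L2_norm f \<le> C"
proof -
  have [measurable]: "f \<in> borel_measurable lborel" using assms by simp
  have "(\<integral>\<^sup>+x. ennreal (norm ((cmod (f x))\<^sup>2)) \<partial>lborel) < \<infinity>"
    using assms(3) by (simp add: order_le_less_trans)
  then have "integrable lborel (\<lambda>x. (cmod (f x))\<^sup>2)"
    by (intro integrableI_bounded) measurable
  then show *: "square_integrable f" using assms by (simp add: square_integrable_def)
  have "(L2_norm f)\<^sup>2 \<le> C\<^sup>2"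
    using assms(3) nn_integral_L2_norm[OF *] by simp
  then show "L2_norm f \<le> C" using assms(2) by (rule power2_le_imp_le)
qed

lemma L2_Cauchy_Schwarz:
  assumes "square_integrable f" "square_integrable g"
  shows "integrable lborel (\<lambda>x. f x * g x)"
    and "cmod (LINT x|lborel. f x * g x) \<le> L2_norm f * L2_norm g"
proof -
  have [measurable]: "f \<in> borel_measurable lborel" "g \<in> borel_measurable lborel"
    using assms by (auto simp: square_integrable_def)
  have "integrable lborel (\<lambda>x. (cmod (f x))\<^sup>2 + (cmod (g x))\<^sup>2)"
    using assms by (simp add: square_integrable_def)
  then show i: "integrable lborel (\<lambda>x. f x * g x)"
  proof (rule Bochner_Integration.integrable_bound)
    have "norm (f x * g x) \<le> norm ((cmod (f x))\<^sup>2 + (cmod (g x))\<^sup>2)" for x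
    proof -
      have "cmod (f x) * cmod (g x) \<le> (cmod (f x))\<^sup>2 + (cmod (g x))\<^sup>2"
        using sum_squares_bound[of "cmod (f x)" "cmod (g x)"]
          mult_nonneg_nonneg[OF norm_ge_zero[of "f x"] norm_ge_zero[of "g x"]]
        by linarith
      then show ?thesis by (simp add: norm_mult)
    qed
    then show "AE x in lborel. norm (f x * g x) \<le> norm ((cmod (f x))\<^sup>2 + (cmod (g x))\<^sup>2)"
      by simp
  qed measurable
  define I where "I = (LINT x|lborel. cmod (f x * g x))"
  have I0: "0 \<le> I" by (simp add: I_def)
  have "ennreal (I\<^sup>2) = (\<integral>\<^sup>+x. ennreal (cmod (f x)) * ennreal (cmod (g x)) \<partial>lborel)\<^sup>2"
  proof -
    have "(\<integral>\<^sup>+x. ennreal (cmod (f x)) * ennreal (cmod (g x)) \<partial>lborel) = ennreal I"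
      using nn_integral_eq_integral[OF integrable_norm[OF i]]
      by (simp add: I_def norm_mult ennreal_mult)
    then show ?thesis using I0 by (simp add: ennreal_power)
  qed
  also have "\<dots> \<le> (\<integral>\<^sup>+x. (ennreal (cmod (f x)))\<^sup>2 \<partial>lborel) * (\<integral>\<^sup>+x. (ennreal (cmod (g x)))\<^sup>2 \<partial>lborel)"
    by (rule Cauchy_Schwarz_nn_integral) auto
  also have "\<dots> = ennreal ((L2_norm f * L2_norm g)\<^sup>2)"
    by (simp add: ennreal_power nn_integral_L2_norm assms ennreal_mult power_mult_distrib)
  finally have "I\<^sup>2 \<le> (L2_norm f * L2_norm g)\<^sup>2"
    by simp
  then have "I \<le> L2_norm f * L2_norm g" by (rule power2_le_imp_le) simp
  then show "cmod (LINT x|lborel. f x * g x) \<le> L2_norm f * L2_norm g"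
    using integral_norm_bound[of lborel "\<lambda>x. f x * g x"] unfolding I_def by (rule order_trans[rotated])
qed

lemma square_integrable_cnj: "square_integrable f \<Longrightarrow> square_integrable (\<lambda>x. cnj (f x))"
  by (auto simp: square_integrable_def intro!: borel_measurable_cnj)

lemma L2_norm_cnj: "L2_norm (\<lambda>x. cnj (f x)) = L2_norm f"
  by (simp add: L2_norm_def)

text \<open>
  The polarisation identity reduces convergence in \<open>L\<^sup>2\<close> to convergence of norms and inner products.
\<close>

lemma L2_norm_diff_sq:
  assumes "square_integrable f" "square_integrable g"
  shows "(L2_norm (\<lambda>x. f x - g x))\<^sup>2
    = (L2_norm f)\<^sup>2 + (L2_norm g)\<^sup>2 - 2 * Re (LINT x|lborel. f x * cnj (g x))"
proof -
  have i: "integrable lborel (\<lambda>x. f x * cnj (g x))"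
    by (intro L2_Cauchy_Schwarz square_integrable_cnj assms)
  have "(cmod (u - v))\<^sup>2 = (cmod u)\<^sup>2 + (cmod v)\<^sup>2 - 2 * Re (u * cnj v)" for u v
    unfolding cmod_power2 by (simp add: algebra_simps power2_eq_square)
  then have "(L2_norm (\<lambda>x. f x - g x))\<^sup>2
    = (LINT x|lborel. (cmod (f x))\<^sup>2 + (cmod (g x))\<^sup>2 - 2 * Re (f x * cnj (g x)))"
    by (simp add: L2_norm_sq)
  also have "\<dots> = (L2_norm f)\<^sup>2 + (L2_norm g)\<^sup>2 - 2 * Re (LINT x|lborel. f x * cnj (g x))"
    using assms i by (simp add: L2_norm_sq square_integrable_def integral_Re del: times_complex.sel)
  finally show ?thesis .
qed

lemma L2_norm_triangle_diff:
  assumes "square_integrable f" "square_integrable g"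
  shows "L2_norm (\<lambda>x. f x - g x) \<le> L2_norm f + L2_norm g"
proof (rule power2_le_imp_le)
  have "- Re (LINT x|lborel. f x * cnj (g x)) \<le> L2_norm f * L2_norm g"
    using L2_Cauchy_Schwarz(2)[OF assms(1) square_integrable_cnj[OF assms(2)]]
      abs_Re_le_cmod[of "LINT x|lborel. f x * cnj (g x)"] by (simp add: L2_norm_cnj)
  then show "(L2_norm (\<lambda>x. f x - g x))\<^sup>2 \<le> (L2_norm f + L2_norm g)\<^sup>2"
    unfolding L2_norm_diff_sq[OF assms] by (simp add: power2_sum)
qed simp

lemma L2_norm_triangle_mid:
  assumes "square_integrable f" "square_integrable g" "square_integrable h"
  shows "L2_norm (\<lambda>x. f x - h x) \<le> L2_norm (\<lambda>x. f x - g x) + L2_norm (\<lambda>x. g x - h x)"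
  using L2_norm_triangle_diff[OF square_integrable_diff[OF assms(1,2)] square_integrable_diff[OF assms(3,2)]]
  by (simp add: L2_norm_minus_commute[of h g])

lemma L2_norm_reverse_triangle:
  assumes "square_integrable f" "square_integrable g"
  shows "\<bar>L2_norm f - L2_norm g\<bar> \<le> L2_norm (\<lambda>x. f x - g x)"
proof -
  have "L2_norm f \<le> L2_norm (\<lambda>x. f x - g x) + L2_norm g"
    using L2_norm_triangle_mid[OF assms, of "\<lambda>_. 0"] by (simp add: square_integrable_def)
  moreover have "L2_norm g \<le> L2_norm (\<lambda>x. g x - f x) + L2_norm f"
    using L2_norm_triangle_mid[OF assms(2,1), of "\<lambda>_. 0"] by (simp add: square_integrable_def)
  ultimately show ?thesis by (simp add: L2_norm_minus_commute[of g f])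
qed

lemma L2_norm_tendsto:
  assumes "\<And>n. square_integrable (f n)" "square_integrable g"
    and "((\<lambda>n. L2_norm (\<lambda>x. f n x - g x)) \<longlongrightarrow> 0) F"
  shows "((\<lambda>n. L2_norm (f n)) \<longlongrightarrow> L2_norm g) F"
proof -
  have "((\<lambda>n. L2_norm (f n) - L2_norm g) \<longlongrightarrow> 0) F"
    using L2_norm_reverse_triangle[OF assms(1,2)]
    by (intro Lim_null_comparison[OF _ assms(3)] always_eventually) simp
  then show ?thesis by (simp add: LIM_zero_iff)
qed

lemma L2_inner_tendsto:
  assumes "square_integrable f" "\<And>n. square_integrable (g n)" "square_integrable h"
    and "((\<lambda>n. L2_norm (\<lambda>x. g n x - h x)) \<longlongrightarrow> 0) F"
  shows "((\<lambda>n. LINT x|lborel. f x * cnj (g n x)) \<longlongrightarrow> (LINT x|lborel. f x * cnj (h x))) F"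
proof -
  have "((\<lambda>n. (LINT x|lborel. f x * cnj (g n x)) - (LINT x|lborel. f x * cnj (h x))) \<longlongrightarrow> 0) F"
  proof (rule Lim_null_comparison[OF always_eventually])
    show "((\<lambda>n. L2_norm f * L2_norm (\<lambda>x. g n x - h x)) \<longlongrightarrow> 0) F"
      using tendsto_mult_left[OF assms(4), of "L2_norm f"] by simp
    show "\<forall>n. norm ((LINT x|lborel. f x * cnj (g n x)) - (LINT x|lborel. f x * cnj (h x)))
            \<le> L2_norm f * L2_norm (\<lambda>x. g n x - h x)"
    proof
      fix n
      have "(LINT x|lborel. f x * cnj (g n x)) - (LINT x|lborel. f x * cnj (h x))
          = (LINT x|lborel. f x * cnj (g n x) - f x * cnj (h x))"
        by (rule Bochner_Integration.integral_diff[symmetric])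
          (intro L2_Cauchy_Schwarz square_integrable_cnj assms)+
      also have "\<dots> = (LINT x|lborel. f x * cnj (g n x - h x))"
        by (simp add: algebra_simps)
      finally show "norm ((LINT x|lborel. f x * cnj (g n x)) - (LINT x|lborel. f x * cnj (h x)))
            \<le> L2_norm f * L2_norm (\<lambda>x. g n x - h x)"
        using L2_Cauchy_Schwarz(2)[OF assms(1) square_integrable_cnj[OF square_integrable_diff[OF assms(2,3)]], of n]
        by (simp only: L2_norm_cnj)
    qed
  qed
  then show ?thesis by (simp add: LIM_zero_iff)
qed

lemma L2_truncation_tendsto:
  assumes "square_integrable f"
  shows "((\<lambda>R. L2_norm (\<lambda>x. indicator {-R..R} x * f x - f x)) \<longlongrightarrow> 0) at_top"
proof -
  have [measurable]: "f \<in> borel_measurable lborel"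
    using assms by (auto simp: square_integrable_def)
  have "((\<lambda>R. LINT x|lborel. (cmod (indicator {-R..R} x * f x - f x))\<^sup>2) \<longlongrightarrow> (LINT x|(lborel::real measure). 0::real)) at_top"
  proof (rule integral_dominated_convergence_at_top)
    show "integrable lborel (\<lambda>x. (cmod (f x))\<^sup>2)" using assms by (simp add: square_integrable_def)
    show "AE x in lborel. ((\<lambda>R. (cmod (indicator {-R..R} x * f x - f x))\<^sup>2) \<longlongrightarrow> 0) at_top"
    proof (rule AE_I2)
      fix x :: real
      have "eventually (\<lambda>R. (cmod (indicator {-R..R} x * f x - f x))\<^sup>2 = 0) at_top"
        using eventually_ge_at_top[of "\<bar>x\<bar>"] by eventually_elim (auto simp: indicator_def)
      then show "((\<lambda>R. (cmod (indicator {-R..R} x * f x - f x))\<^sup>2) \<longlongrightarrow> 0) at_top"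
        by (rule tendsto_eventually)
    qed
    show "\<forall>\<^sub>F R in at_top. AE x in lborel. norm ((cmod (indicator {-R..R} x * f x - f x))\<^sup>2) \<le> (cmod (f x))\<^sup>2"
      by (intro always_eventually allI AE_I2) (auto simp: indicator_def)
  qed auto
  then have "((\<lambda>R. (L2_norm (\<lambda>x. indicator {-R..R} x * f x - f x))\<^sup>2) \<longlongrightarrow> 0) at_top"
    by (simp add: L2_norm_sq)
  from tendsto_real_sqrt[OF this] show ?thesis by simp
qed

lemma L2_truncation_integrable:
  assumes "square_integrable f"
  shows "integrable lborel (\<lambda>x. indicator {-R..R} x * f x)"
proof -
  have "square_integrable (indicator {-R..R} :: real \<Rightarrow> complex)"
  proof -
    have "(cmod (indicator {-R..R} x))\<^sup>2 = indicator {-R..R} x" for x :: real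
      by (simp add: indicator_def)
    moreover have "integrable lborel (indicator {-R..R} :: real \<Rightarrow> real)"
      by (rule integrable_real_indicator) (auto simp: emeasure_lborel_Icc_eq)
    ultimately show ?thesis by (simp add: square_integrable_def)
  qed
  then show ?thesis using assms by (rule L2_Cauchy_Schwarz)
qed

text \<open>
  Along a subsequence whose increments \<open>u k\<close> have \<open>L\<^sup>2\<close> norm at most \<open>(1/4) ^ k\<close>, even the
  weighted sum of the \<open>2 ^ k * \<bar>u k\<bar>\<^sup>2\<close> has a finite integral. It is therefore finite almost everywhere,
  which forces geometric decay of the increments and pointwise convergence. Fatou's lemma then
  turns the pointwise limit into a limit in \<open>L\<^sup>2\<close>, of the whole sequence because it is Cauchy.
\<close>

lemma Riesz_Fischer:
  assumes f: "\<And>n::nat. square_integrable (f n)"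
    and Cauchy: "\<And>e. e > 0 \<Longrightarrow> \<exists>N. \<forall>m\<ge>N. \<forall>n\<ge>N. L2_norm (\<lambda>x. f m x - f n x) < e"
  shows "\<exists>g. square_integrable g \<and> (\<lambda>n. L2_norm (\<lambda>x. f n x - g x)) \<longlonglongrightarrow> 0"
proof -
  have [measurable]: "\<And>n. f n \<in> borel_measurable lborel"
    using f by (auto simp: square_integrable_def)
  have "\<exists>r. strict_mono r \<and> (\<forall>k. \<forall>m\<ge>r k. \<forall>n\<ge>r k. L2_norm (\<lambda>x. f m x - f n x) < (1/4) ^ k)"
  proof -
    define P where "P k N \<longleftrightarrow> (\<forall>m\<ge>N. \<forall>n\<ge>N. L2_norm (\<lambda>x. f m x - f n x) < (1/4) ^ k)" for k :: nat and N :: nat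
    have P: "\<exists>N'>N. P k N'" for k N
    proof -
      from Cauchy[of "(1/4)^k"] obtain M where "P k M" by (auto simp: P_def)
      then have "P k (max M (Suc N))" by (auto simp: P_def)
      then show ?thesis by (intro exI[of _ "max M (Suc N)"]) auto
    qed
    then have "\<exists>r. \<forall>k. P k (r k) \<and> r k < r (Suc k)"
      by (intro dependent_nat_choice) (use P in blast)+
    then show ?thesis unfolding P_def strict_mono_Suc_iff by blast
  qed
  then obtain r where r: "strict_mono r"
    and rc: "\<And>k m n. m \<ge> r k \<Longrightarrow> n \<ge> r k \<Longrightarrow> L2_norm (\<lambda>x. f m x - f n x) < (1/4) ^ k"
    by blast
  define u where "u k x = f (r (Suc k)) x - f (r k) x" for k x
  have usq: "square_integrable (u k)" for k
    unfolding u_def[abs_def] by (intro square_integrable_diff f)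
  have ub: "(L2_norm (u k))\<^sup>2 \<le> (1/16) ^ k" for k
  proof -
    have "L2_norm (u k) < (1/4)^k"
      using rc[of k "r (Suc k)" "r k"] r by (simp add: u_def[abs_def] strict_mono_less_eq)
    then have "(L2_norm (u k))\<^sup>2 \<le> ((1/4)^k)\<^sup>2" by (intro power_mono) auto
    also have "((1/4)^k)\<^sup>2 = ((1/4)\<^sup>2 :: real) ^ k" by (simp only: power_mult[symmetric] mult.commute)
    finally show ?thesis by (simp add: power2_eq_square)
  qed
  have [measurable]: "\<And>k. u k \<in> borel_measurable lborel"
    using usq by (auto simp: square_integrable_def)
  have "(\<integral>\<^sup>+x. (\<Sum>k. ennreal (2^k * (cmod (u k x))\<^sup>2)) \<partial>lborel)
      = (\<Sum>k. \<integral>\<^sup>+x. ennreal (2^k * (cmod (u k x))\<^sup>2) \<partial>lborel)"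
    by (rule nn_integral_suminf) measurable
  also have "\<dots> = (\<Sum>k. ennreal (2^k * (L2_norm (u k))\<^sup>2))"
    by (simp add: ennreal_mult nn_integral_cmult nn_integral_L2_norm usq)
  also have "\<dots> \<le> (\<Sum>k. ennreal ((1/8)^k))"
  proof (intro suminf_le ennreal_leI)
    fix k
    have "2^k * (L2_norm (u k))\<^sup>2 \<le> 2^k * (1/16)^k" using ub[of k] by simp
    then show "2^k * (L2_norm (u k))\<^sup>2 \<le> (1/8)^k" by (simp add: power_mult_distrib[symmetric])
  qed auto
  also have "\<dots> = ennreal (\<Sum>k. (1/8)^k)"
    by (rule suminf_ennreal2) (auto intro: summable_geometric)
  finally have "(\<integral>\<^sup>+x. (\<Sum>k. ennreal (2^k * (cmod (u k x))\<^sup>2)) \<partial>lborel) \<noteq> \<infinity>"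
    by (auto simp: top_unique)
  then have "AE x in lborel. (\<Sum>k. ennreal (2^k * (cmod (u k x))\<^sup>2)) \<noteq> \<infinity>"
    by (intro nn_integral_PInf_AE) measurable
  then have AE_conv: "AE x in lborel. convergent (\<lambda>k. f (r k) x)"
  proof (rule AE_mp, intro AE_I2 impI)
    fix x assume fin: "(\<Sum>k. ennreal (2^k * (cmod (u k x))\<^sup>2)) \<noteq> \<infinity>"
    have "summable (\<lambda>k. 2^k * (cmod (u k x))\<^sup>2)"
      by (rule summable_suminf_not_top) (use fin in auto)
    then have "Bseq (\<lambda>k. 2^k * (cmod (u k x))\<^sup>2)"
      by (intro convergent_imp_Bseq) (auto simp: convergent_def dest: summable_LIMSEQ_zero)
    then obtain B where B: "B > 0" "\<And>k. norm (2^k * (cmod (u k x))\<^sup>2) \<le> B"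
      by (auto simp: Bseq_def)
    have ux: "cmod (u k x) \<le> sqrt B * (1 / sqrt 2) ^ k" for k
    proof (rule power2_le_imp_le)
      have "(cmod (u k x))\<^sup>2 \<le> B / 2^k" using B(2)[of k] by (simp add: field_simps)
      also have "\<dots> = (sqrt B * (1 / sqrt 2) ^ k)\<^sup>2"
        using B(1) by (simp add: power_mult_distrib power_divide power_mult[symmetric] mult.commute[of k])
          (simp add: power_mult)
      finally show "(cmod (u k x))\<^sup>2 \<le> (sqrt B * (1 / sqrt 2) ^ k)\<^sup>2" .
    qed (use B in auto)
    have "summable (\<lambda>k. u k x)"
    proof (rule summable_comparison_test')
      show "summable (\<lambda>k. sqrt B * (1 / sqrt 2) ^ k)"
        by (intro summable_mult summable_geometric) (auto simp: real_less_rsqrt)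
    qed (use ux in auto)
    then have "convergent (\<lambda>n. f (r 0) x + (\<Sum>k<n. u k x))"
      by (simp add: summable_iff_convergent convergent_add_const_iff)
    moreover have "f (r 0) x + (\<Sum>k<n. u k x) = f (r n) x" for n
      unfolding u_def by (subst sum_lessThan_telescope) simp
    ultimately show "convergent (\<lambda>k. f (r k) x)" by simp
  qed
  define g where "g x = lim (\<lambda>k. f (r k) x)" for x
  have g[measurable]: "g \<in> borel_measurable lborel"
    unfolding g_def[abs_def] by (rule borel_measurable_lim_metric) measurable
  (* Where the subsequence diverges, g has an arbitrary value. *)
  have AE_lim: "AE x in lborel. (\<lambda>k. f (r k) x) \<longlonglongrightarrow> g x"
    using AE_conv by eventually_elim (simp add: g_def convergent_LIMSEQ_iff)
  have key: "square_integrable (\<lambda>x. f n x - g x) \<and> L2_norm (\<lambda>x. f n x - g x) \<le> e"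
    if e: "e > 0" and N: "\<forall>m\<ge>N. \<forall>n\<ge>N. L2_norm (\<lambda>x. f m x - f n x) < e" and n: "n \<ge> N" for e N n
  proof -
    have "(\<integral>\<^sup>+x. ennreal ((cmod (f n x - g x))\<^sup>2) \<partial>lborel)
        = (\<integral>\<^sup>+x. liminf (\<lambda>k. ennreal ((cmod (f n x - f (r k) x))\<^sup>2)) \<partial>lborel)"
    proof (rule nn_integral_cong_AE, use AE_lim in eventually_elim)
      fix x assume "(\<lambda>k. f (r k) x) \<longlonglongrightarrow> g x"
      then have "(\<lambda>k. ennreal ((cmod (f n x - f (r k) x))\<^sup>2)) \<longlonglongrightarrow> ennreal ((cmod (f n x - g x))\<^sup>2)"
        by (intro tendsto_intros)
      then show "ennreal ((cmod (f n x - g x))\<^sup>2) = liminf (\<lambda>k. ennreal ((cmod (f n x - f (r k) x))\<^sup>2))"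
        by (intro lim_imp_Liminf[symmetric] trivial_limit_sequentially)
    qed
    also have "\<dots> \<le> liminf (\<lambda>k. \<integral>\<^sup>+x. ennreal ((cmod (f n x - f (r k) x))\<^sup>2) \<partial>lborel)"
      by (rule nn_integral_liminf) measurable
    also have "\<dots> = liminf (\<lambda>k. ennreal ((L2_norm (\<lambda>x. f n x - f (r k) x))\<^sup>2))"
      by (simp add: nn_integral_L2_norm square_integrable_diff f)
    also have "\<dots> \<le> liminf (\<lambda>k. ennreal (e\<^sup>2))"
    proof (intro Liminf_mono eventually_sequentiallyI[of N] ennreal_leI power_mono)
      fix k assume "k \<ge> N"
      then have "r k \<ge> N" using strict_mono_imp_increasing[OF r, of k] by simp
      then show "L2_norm (\<lambda>x. f n x - f (r k) x) \<le> e" using N n by (intro less_imp_le) auto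
    qed auto
    also have "\<dots> = ennreal (e\<^sup>2)" by (simp add: Liminf_const)
    finally show ?thesis
      using e square_integrable_bounded_nn_integral[of "\<lambda>x. f n x - g x" e] by simp
  qed
  have "square_integrable g"
  proof -
    from Cauchy[of 1] obtain N where "\<forall>m\<ge>N. \<forall>n\<ge>N. L2_norm (\<lambda>x. f m x - f n x) < 1" by auto
    from key[OF _ this, of N] have "square_integrable (\<lambda>x. f N x - g x)" by simp
    from square_integrable_diff[OF f this, of N] show ?thesis by simp
  qed
  moreover have "(\<lambda>n. L2_norm (\<lambda>x. f n x - g x)) \<longlonglongrightarrow> 0"
  proof (rule LIMSEQ_I)
    fix e :: real assume e: "e > 0"
    from Cauchy[of "e/2"] e obtain N where N: "\<forall>m\<ge>N. \<forall>n\<ge>N. L2_norm (\<lambda>x. f m x - f n x) < e/2" by auto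
    show "\<exists>N. \<forall>n\<ge>N. norm (L2_norm (\<lambda>x. f n x - g x) - 0) < e"
    proof (intro exI allI impI)
      fix n assume "n \<ge> N"
      from key[OF _ N this] e show "norm (L2_norm (\<lambda>x. f n x - g x) - 0) < e" by simp
    qed
  qed
  ultimately show ?thesis by blast
qed

section \<open>Plancherel's theorem\<close>

lemma norm_fourier_kernel [simp]: "cmod (exp (- (\<i> * of_real t))) = 1"
  by (simp add: norm_exp_eq_Re)

lemma fourier_measurable [measurable]:
  assumes [measurable]: "f \<in> borel_measurable borel"
  shows "fourier f \<in> borel_measurable borel"
  unfolding fourier_def[abs_def] by measurable

lemma fourier_kernel_integrable:
  assumes "integrable lborel f"
  shows "integrable lborel (\<lambda>x. exp (- (\<i> * of_real (x * \<xi>))) * f x)"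
proof -
  have [measurable]: "f \<in> borel_measurable lborel" using assms by auto
  show ?thesis
    by (rule Bochner_Integration.integrable_bound[OF assms]) (auto simp: norm_mult simp del: of_real_mult)
qed

lemma cmod_fourier_le: "cmod (fourier f \<xi>) \<le> (LINT x|lborel. cmod (f x))"
proof -
  have "cmod (fourier f \<xi>) \<le> (LINT x|lborel. cmod (exp (- (\<i> * of_real (x * \<xi>))) * f x))"
    unfolding fourier_def by (rule integral_norm_bound)
  then show ?thesis by (simp add: norm_mult del: of_real_mult)
qed

lemma fourier_diff:
  assumes "integrable lborel f" "integrable lborel g"
  shows "fourier (\<lambda>x. f x - g x) \<xi> = fourier f \<xi> - fourier g \<xi>"
  using fourier_kernel_integrable[OF assms(1), of \<xi>] fourier_kernel_integrable[OF assms(2), of \<xi>]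
  by (simp add: fourier_def right_diff_distrib)

lemma fourier_cnj: "fourier (\<lambda>x. cnj (f x)) \<xi> = cnj (fourier f (- \<xi>))"
  unfolding fourier_def Bochner_Integration.integral_cnj[symmetric] by (simp add: exp_cnj)

text \<open>
  The hypothesis of Fubini's theorem for an integral kernel of modulus one, such as that of the
  Fourier transform.
\<close>

lemma integrable_pair_product:
  fixes f g :: "real \<Rightarrow> complex"
  assumes f: "integrable lborel f" and g: "integrable lborel g"
    and k: "(\<lambda>(x, y). k x y) \<in> borel_measurable (lborel \<Otimes>\<^sub>M lborel)" "\<And>x y. cmod (k x y) = 1"
  shows "integrable (lborel \<Otimes>\<^sub>M lborel) (\<lambda>(x, y). k x y * f x * g y)"
proof (rule lborel_pair.Fubini_integrable)
  note [measurable] = borel_measurable_integrable[OF f] borel_measurable_integrable[OF g] k(1)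
  show "(\<lambda>(x, y). k x y * f x * g y) \<in> borel_measurable (lborel \<Otimes>\<^sub>M lborel)"
    by measurable
  show "integrable lborel (\<lambda>x. LINT y|lborel. norm (case (x, y) of (x, y) \<Rightarrow> k x y * f x * g y))"
    using f by (simp add: norm_mult k)
  show "AE x in lborel. integrable lborel (\<lambda>y. case (x, y) of (x, y) \<Rightarrow> k x y * f x * g y)"
  proof (rule AE_I2)
    fix x
    have [measurable]: "(\<lambda>y. k x y) \<in> borel_measurable lborel" by measurable
    have "integrable lborel (\<lambda>y. f x * g y)" using g by simp
    then show "integrable lborel (\<lambda>y. case (x, y) of (x, y) \<Rightarrow> k x y * f x * g y)"
      by (rule Bochner_Integration.integrable_bound) (auto simp: norm_mult k)
  qed
qed

text \<open>
  By Fubini's theorem both sides are the double integral of \<open>exp (- \<i> x \<xi>) f x g \<xi>\<close>.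
\<close>

lemma fourier_multiplication_formula:
  assumes f: "integrable lborel f" and g: "integrable lborel g"
  shows "(LINT \<xi>|lborel. fourier f \<xi> * g \<xi>) = (LINT x|lborel. f x * fourier g x)"
proof -
  have "integrable (lborel \<Otimes>\<^sub>M lborel) (\<lambda>(x, \<xi>). exp (- (\<i> * of_real (x * \<xi>))) * f x * g \<xi>)"
    by (rule integrable_pair_product[OF f g]) (auto simp del: of_real_mult)
  from lborel_pair.Fubini_integral[OF this]
  have *: "(LINT \<xi>|lborel. LINT x|lborel. exp (- (\<i> * of_real (x * \<xi>))) * f x * g \<xi>)
     = (LINT x|lborel. LINT \<xi>|lborel. exp (- (\<i> * of_real (x * \<xi>))) * f x * g \<xi>)" .
  have "(LINT x|lborel. exp (- (\<i> * of_real (x * \<xi>))) * f x * g \<xi>) = fourier f \<xi> * g \<xi>" for \<xi>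
    unfolding fourier_def by simp
  moreover have "(LINT \<xi>|lborel. exp (- (\<i> * of_real (x * \<xi>))) * f x * g \<xi>) = f x * fourier g x" for x
  proof -
    have "(LINT \<xi>|lborel. exp (- (\<i> * of_real (x * \<xi>))) * f x * g \<xi>)
        = (LINT \<xi>|lborel. f x * (exp (- (\<i> * of_real (\<xi> * x))) * g \<xi>))"
      by (rule Bochner_Integration.integral_cong) (simp_all add: mult_ac del: of_real_mult)
    then show ?thesis unfolding fourier_def by simp
  qed
  ultimately show ?thesis using * by (simp only:)
qed

text \<open>
  Up to scaling this is the characteristic function of the standard normal distribution.
\<close>

lemma fourier_gaussian:
  assumes "n > 0"
  shows "fourier (\<lambda>\<xi>. of_real (exp (- (\<xi> / n)\<^sup>2 / 2))) x
    = of_real (n * sqrt (2 * pi) * exp (- (n * x)\<^sup>2 / 2))"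
proof -
  have "char std_normal_distribution (- (n * x))
      = (LINT y|lborel. std_normal_density y *\<^sub>R exp (\<i> * of_real (- (n * x) * y)))"
    unfolding char_def by (subst integral_density) (auto simp: normal_density_nonneg)
  then have *: "(LINT y|lborel. std_normal_density y *\<^sub>R exp (\<i> * of_real (- (n * x) * y)))
      = of_real (exp (- (n * x)\<^sup>2 / 2))"
    by (simp add: char_std_normal_distribution)
  have "fourier (\<lambda>\<xi>. of_real (exp (- (\<xi> / n)\<^sup>2 / 2))) x
      = n *\<^sub>R (LINT y|lborel. exp (- (\<i> * of_real ((n * y) * x))) * of_real (exp (- (n * y / n)\<^sup>2 / 2)))"
    unfolding fourier_def using assms
    by (subst lborel_integral_real_affine[where c = n and t = 0]) simp_all
  also have "\<dots> = n *\<^sub>R (LINT y|lborel. of_real (sqrt (2 * pi)) *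
        (std_normal_density y *\<^sub>R exp (\<i> * of_real (- (n * x) * y))))"
  proof -
    have "exp (- (\<i> * of_real ((n * y) * x))) * of_real (exp (- (n * y / n)\<^sup>2 / 2))
       = complex_of_real (sqrt (2 * pi)) * (std_normal_density y *\<^sub>R exp (\<i> * of_real (- (n * x) * y)))" for y
      using assms by (simp add: std_normal_density_def scaleR_conv_of_real mult_ac)
    then show ?thesis by simp
  qed
  also have "\<dots> = n *\<^sub>R (of_real (sqrt (2 * pi)) * of_real (exp (- (n * x)\<^sup>2 / 2)))"
    unfolding integral_mult_right_zero * ..
  finally show ?thesis by (simp add: scaleR_conv_of_real)
qed

lemma lborel_integral_translate:
  fixes f :: "real \<Rightarrow> 'a::{banach, second_countable_topology}"
  shows "(LINT x|lborel. f (x + h)) = (LINT x|lborel. f x)"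
  using lborel_integral_real_affine[of 1 f h] by (simp add: add.commute)

lemma lborel_integrable_translate:
  fixes f :: "real \<Rightarrow> 'a::{banach, second_countable_topology}"
  shows "integrable lborel f \<Longrightarrow> integrable lborel (\<lambda>x. f (x + h))"
  using lborel_integrable_real_affine[of f 1 h] by (simp add: add.commute)

text \<open>
  Translation preserves the \<open>L\<^sup>1\<close> norm, so continuity of translation passes to \<open>L\<^sup>1\<close> limits by an
  \<open>\<epsilon>/3\<close> argument. This reduces the claim for all integrable functions to indicators of open sets.
\<close>

lemma L1_translation_approx:
  fixes f :: "real \<Rightarrow> complex"
  assumes f: "integrable lborel f"
    and approx: "\<And>e. e > 0 \<Longrightarrow> \<exists>g. integrable lborel g \<and> (LINT x|lborel. cmod (f x - g x)) < e \<and>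
        (\<lambda>n. LINT x|lborel. cmod (g (x + X n) - g x)) \<longlonglongrightarrow> 0"
  shows "(\<lambda>n. LINT x|lborel. cmod (f (x + X n) - f x)) \<longlonglongrightarrow> 0"
proof (rule LIMSEQ_I)
  fix e :: real assume e: "e > 0"
  from approx[of "e/3"] e obtain g where g: "integrable lborel g"
    and fg: "(LINT x|lborel. cmod (f x - g x)) < e/3"
    and gX: "(\<lambda>n. LINT x|lborel. cmod (g (x + X n) - g x)) \<longlonglongrightarrow> 0" by auto
  from LIMSEQ_D[OF gX, of "e/3"] e obtain N
    where N: "\<And>n. n \<ge> N \<Longrightarrow> (LINT x|lborel. cmod (g (x + X n) - g x)) < e/3" by auto
  show "\<exists>N. \<forall>n\<ge>N. norm ((LINT x|lborel. cmod (f (x + X n) - f x)) - 0) < e"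
  proof (intro exI allI impI)
    fix n assume n: "n \<ge> N"
    note i = lborel_integrable_translate[OF f, of "X n"] lborel_integrable_translate[OF g, of "X n"] f g
    have "(LINT x|lborel. cmod (f (x + X n) - f x))
      \<le> (LINT x|lborel. cmod (f (x + X n) - g (x + X n)) + (cmod (g (x + X n) - g x) + cmod (f x - g x)))"
    proof (rule integral_mono)
      fix x
      show "cmod (f (x + X n) - f x)
        \<le> cmod (f (x + X n) - g (x + X n)) + (cmod (g (x + X n) - g x) + cmod (f x - g x))"
        using norm_triangle_ineq[of "f (x + X n) - g (x + X n)" "(g (x + X n) - g x) - (f x - g x)"]
          norm_triangle_ineq4[of "g (x + X n) - g x" "f x - g x"] by simp
    qed (use i in auto)
    also have "\<dots> = (LINT x|lborel. cmod (f (x + X n) - g (x + X n)))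
        + ((LINT x|lborel. cmod (g (x + X n) - g x)) + (LINT x|lborel. cmod (f x - g x)))"
      using i by simp
    also have "(LINT x|lborel. cmod (f (x + X n) - g (x + X n))) = (LINT x|lborel. cmod (f x - g x))"
      by (rule lborel_integral_translate[where f = "\<lambda>x. cmod (f x - g x)"])
    finally show "norm ((LINT x|lborel. cmod (f (x + X n) - f x)) - 0) < e"
      using N[OF n] fg by simp
  qed
qed

text \<open>
  A set \<open>U\<close> and its translate have equal measure, so their symmetric difference has twice the measure
  of the part of \<open>U\<close> missed by the translate. If \<open>U\<close> is open, the indicators of the translates
  converge to \<open>1\<close> pointwise on \<open>U\<close>, so that this part shrinks to nothing.
\<close>

lemma L1_translation_open:
  fixes U :: "real set" and c :: complex
  assumes U: "open U" "emeasure lborel U < \<infinity>" and X: "X \<longlonglongrightarrow> 0"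
  shows "(\<lambda>n. LINT x|lborel. cmod (indicator U (x + X n) *\<^sub>R c - indicator U x *\<^sub>R c)) \<longlonglongrightarrow> 0"
proof -
  have [measurable]: "U \<in> sets borel" using U by simp
  have iU: "integrable lborel (indicat_real U)" using U by auto
  have iUt: "integrable lborel (\<lambda>x. indicat_real U (x + h))" for h
    by (rule lborel_integrable_translate[OF iU])
  have iUU: "integrable lborel (\<lambda>x. indicat_real U x * indicat_real U (x + h))" for h
    by (rule Bochner_Integration.integrable_bound[OF iU]) (auto simp: indicator_def)
  have eq: "(LINT x|lborel. cmod (indicator U (x + h) *\<^sub>R c - indicator U x *\<^sub>R c))
     = 2 * cmod c * (LINT x|lborel. indicat_real U x - indicat_real U x * indicat_real U (x + h))" for h
  proof -
    have "cmod (indicator U (x + h) *\<^sub>R c - indicator U x *\<^sub>R c)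
       = cmod c * (indicat_real U (x + h) + indicat_real U x - 2 * (indicat_real U x * indicat_real U (x + h)))" for x
      by (auto simp: indicator_def)
    then have "(LINT x|lborel. cmod (indicator U (x + h) *\<^sub>R c - indicator U x *\<^sub>R c))
      = cmod c * ((LINT x|lborel. indicat_real U (x + h)) + (LINT x|lborel. indicat_real U x)
          - 2 * (LINT x|lborel. indicat_real U x * indicat_real U (x + h)))"
      using iU iUt[of h] iUU[of h] by simp
    then show ?thesis
      using iU iUt[of h] iUU[of h] lborel_integral_translate[of "indicat_real U" h]
      by (simp add: algebra_simps)
  qed
  have "(\<lambda>n. LINT x|lborel. indicat_real U x - indicat_real U x * indicat_real U (x + X n))
     \<longlonglongrightarrow> (LINT x|(lborel::real measure). 0::real)"
  proof (rule integral_dominated_convergence)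
    show "AE x in lborel. (\<lambda>n. indicat_real U x - indicat_real U x * indicat_real U (x + X n)) \<longlonglongrightarrow> 0"
    proof (rule AE_I2)
      fix x
      show "(\<lambda>n. indicat_real U x - indicat_real U x * indicat_real U (x + X n)) \<longlonglongrightarrow> 0"
      proof (cases "x \<in> U")
        case True
        have "(\<lambda>n. x + X n) \<longlonglongrightarrow> x" using tendsto_add[OF tendsto_const X, of x] by simp
        then have "eventually (\<lambda>n. x + X n \<in> U) sequentially"
          using topological_tendstoD[OF _ U(1)] True by blast
        then have "eventually (\<lambda>n. indicat_real U x - indicat_real U x * indicat_real U (x + X n) = 0) sequentially"
          by eventually_elim (simp add: True)
        then show ?thesis by (rule tendsto_eventually)
      qed simp
    qed
    show "AE x in lborel. norm (indicat_real U x - indicat_real U x * indicat_real U (x + X n)) \<le> indicat_real U x" for n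
      by (auto simp: indicator_def)
  qed (use iU in auto)
  from tendsto_mult_left[OF this, of "2 * cmod c"] show ?thesis by (simp add: eq)
qed

text \<open>
  Measurable sets are approximated by open sets (outer regularity), and integrable functions by
  simple ones.
\<close>

lemma L1_translation_continuous:
  fixes f :: "real \<Rightarrow> complex"
  assumes "integrable lborel f" and X: "X \<longlonglongrightarrow> 0"
  shows "(\<lambda>n. LINT x|lborel. cmod (f (x + X n) - f x)) \<longlonglongrightarrow> 0"
  using assms(1)
proof (induction rule: integrable_induct)
  case (base A c)
  have [measurable]: "A \<in> sets borel" using base by simp
  have iA: "integrable lborel (indicat_real A)" using base by auto
  show ?case
  proof (rule L1_translation_approx)
    show "integrable lborel (\<lambda>x. indicator A x *\<^sub>R c)" using iA by simp
    fix e :: real assume e: "e > 0"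
    define e' where "e' = e / (cmod c + 1)"
    have c1: "cmod c + 1 > 0" by (simp add: add_nonneg_pos)
    have e': "e' > 0" using e c1 by (simp add: e'_def)
    obtain U where U: "open U" "A \<subseteq> U" "emeasure lborel (U - A) < e'"
      using outer_regular_lborel[of A e'] e' base by auto
    have [measurable]: "U \<in> sets borel" using U by simp
    have "emeasure lborel U \<le> emeasure lborel (U - A) + emeasure lborel A"
      using U(2) emeasure_subadditive[of "U - A" lborel A] by (simp add: Un_absorb2)
    also have "\<dots> < \<infinity>" using U(3) base by (simp add: order_less_trans[of _ "ennreal e'"])
    finally have Ufin: "emeasure lborel U < \<infinity>" .
    have iU: "integrable lborel (indicat_real U)" using Ufin by auto
    have "cmod (indicator A x *\<^sub>R c - indicator U x *\<^sub>R c) = cmod c * indicat_real (U - A) x" for x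
      using U(2) by (auto simp: indicator_def)
    then have "(LINT x|lborel. cmod (indicator A x *\<^sub>R c - indicator U x *\<^sub>R c))
        = cmod c * measure lborel (U - A)"
      by simp
    also have "measure lborel (U - A) \<le> e'"
      using U(3) e' by (simp add: measure_def enn2real_leI)
    then have "cmod c * measure lborel (U - A) \<le> cmod c * e'" by (simp add: mult_left_mono)
    also have "\<dots> < e"
    proof -
      have "(cmod c + 1) * e' = e" using c1 by (simp add: e'_def)
      then show ?thesis using e' by (simp add: distrib_right)
    qed
    finally have "(LINT x|lborel. cmod (indicator A x *\<^sub>R c - indicator U x *\<^sub>R c)) < e" .
    then show "\<exists>g. integrable lborel g \<and> (LINT x|lborel. cmod (indicator A x *\<^sub>R c - g x)) < e \<and>
        (\<lambda>n. LINT x|lborel. cmod (g (x + X n) - g x)) \<longlonglongrightarrow> 0"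
      using iU L1_translation_open[OF U(1) Ufin X, of c]
      by (intro exI[of _ "\<lambda>x. indicator U x *\<^sub>R c"]) simp
  qed
next
  case (add f g)
  show ?case
  proof (rule tendsto_sandwich[OF _ _ tendsto_const])
    show "(\<lambda>n. (LINT x|lborel. cmod (f (x + X n) - f x)) + (LINT x|lborel. cmod (g (x + X n) - g x))) \<longlonglongrightarrow> 0"
      using tendsto_add[OF add.IH] by simp
    show "eventually (\<lambda>n. (LINT x|lborel. cmod (f (x + X n) + g (x + X n) - (f x + g x)))
        \<le> (LINT x|lborel. cmod (f (x + X n) - f x)) + (LINT x|lborel. cmod (g (x + X n) - g x))) sequentially"
    proof (intro always_eventually allI)
      fix n
      note i = lborel_integrable_translate[OF add(1), of "X n"] lborel_integrable_translate[OF add(2), of "X n"]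
        add(1,2)
      have "(LINT x|lborel. cmod (f (x + X n) + g (x + X n) - (f x + g x)))
        \<le> (LINT x|lborel. cmod (f (x + X n) - f x) + cmod (g (x + X n) - g x))"
      proof (rule integral_mono)
        fix x
        show "cmod (f (x + X n) + g (x + X n) - (f x + g x)) \<le> cmod (f (x + X n) - f x) + cmod (g (x + X n) - g x)"
          using norm_triangle_ineq[of "f (x + X n) - f x" "g (x + X n) - g x"]
          by (simp add: algebra_simps)
      qed (use i in auto)
      also have "\<dots> = (LINT x|lborel. cmod (f (x + X n) - f x)) + (LINT x|lborel. cmod (g (x + X n) - g x))"
        using i by simp
      finally show "(LINT x|lborel. cmod (f (x + X n) + g (x + X n) - (f x + g x)))
        \<le> (LINT x|lborel. cmod (f (x + X n) - f x)) + (LINT x|lborel. cmod (g (x + X n) - g x))" .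
    qed
  qed auto
next
  case (lim f s)
  show ?case
  proof (rule L1_translation_approx)
    fix e :: real assume e: "e > 0"
    have [measurable]: "f \<in> borel_measurable lborel" "\<And>i. s i \<in> borel_measurable lborel"
      using lim by auto
    have "(\<lambda>i. LINT x|lborel. cmod (f x - s i x)) \<longlonglongrightarrow> (LINT x|(lborel::real measure). 0::real)"
    proof (rule integral_dominated_convergence)
      show "integrable lborel (\<lambda>x. 3 * cmod (f x))" using lim by simp
      show "AE x in lborel. (\<lambda>i. cmod (f x - s i x)) \<longlonglongrightarrow> 0"
      proof (rule AE_I2)
        fix x
        have "(\<lambda>i. s i x) \<longlonglongrightarrow> f x" using lim by simp
        then have "(\<lambda>i. cmod (f x - s i x)) \<longlonglongrightarrow> cmod (f x - f x)" by (intro tendsto_intros)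
        then show "(\<lambda>i. cmod (f x - s i x)) \<longlonglongrightarrow> 0" by simp
      qed
      show "AE x in lborel. norm (cmod (f x - s i x)) \<le> 3 * cmod (f x)" for i
      proof (rule AE_I2)
        fix x
        have "cmod (s i x) \<le> 2 * cmod (f x)" using lim by simp
        then show "norm (cmod (f x - s i x)) \<le> 3 * cmod (f x)"
          using norm_triangle_ineq4[of "f x" "s i x"] by simp
      qed
    qed auto
    then have "(\<lambda>i. LINT x|lborel. cmod (f x - s i x)) \<longlonglongrightarrow> 0" by simp
    from LIMSEQ_D[OF this e] obtain i where "(LINT x|lborel. cmod (f x - s i x)) < e" by auto
    then show "\<exists>g. integrable lborel g \<and> (LINT x|lborel. cmod (f x - g x)) < e \<and>
        (\<lambda>n. LINT x|lborel. cmod (g (x + X n) - g x)) \<longlonglongrightarrow> 0"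
      using lim by blast
  qed (use lim in auto)
qed

text \<open>
  The Fourier transform of this function is \<open>\<bar>fourier f\<bar>\<^sup>2\<close> and its value at \<open>0\<close> is the squared norm of \<open>f\<close>, so
  Plancherel's theorem is Fourier inversion at the origin for it.
\<close>

definition autocorrelation :: "(real \<Rightarrow> complex) \<Rightarrow> real \<Rightarrow> complex" where
  "autocorrelation f h = (LINT x|lborel. f (x + h) * cnj (f x))"

lemma square_integrable_translate:
  assumes "square_integrable f"
  shows "square_integrable (\<lambda>x. f (x + h))"
  using assms lborel_integrable_translate[of "\<lambda>x. (cmod (f x))\<^sup>2" h]
  by (auto simp: square_integrable_def)

lemma L2_norm_translate: "L2_norm (\<lambda>x. f (x + h)) = L2_norm f"
  using lborel_integral_translate[of "\<lambda>x. (cmod (f x))\<^sup>2" h] by (simp add: L2_norm_def)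

lemma cmod_autocorrelation_le:
  assumes "square_integrable f"
  shows "cmod (autocorrelation f h) \<le> (L2_norm f)\<^sup>2"
  using L2_Cauchy_Schwarz(2)[OF square_integrable_translate[OF assms] square_integrable_cnj[OF assms], of h]
  by (simp add: autocorrelation_def L2_norm_translate L2_norm_cnj power2_eq_square)

lemma autocorrelation_0: "autocorrelation f 0 = of_real ((L2_norm f)\<^sup>2)"
proof -
  have "f x * cnj (f x) = of_real ((cmod (f x))\<^sup>2)" for x
    by (rule complex_norm_square[symmetric])
  then show ?thesis by (simp add: autocorrelation_def L2_norm_sq del: of_real_power)
qed

lemma autocorrelation_measurable [measurable]:
  assumes [measurable]: "f \<in> borel_measurable borel"
  shows "autocorrelation f \<in> borel_measurable borel"
  unfolding autocorrelation_def[abs_def] by measurable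

lemma fourier_autocorrelation:
  assumes f: "integrable lborel f"
  shows "integrable lborel (autocorrelation f)"
    and "fourier (autocorrelation f) \<xi> = of_real ((cmod (fourier f \<xi>))\<^sup>2)"
proof -
  note [measurable] = borel_measurable_integrable[OF f]
  have [measurable]: "(\<lambda>x. cnj (f x)) \<in> borel_measurable lborel"
    using f by (intro borel_measurable_integrable) simp
  have int: "integrable (lborel \<Otimes>\<^sub>M lborel) (\<lambda>(x, h). k h * (f (x + h) * cnj (f x)))"
    if [measurable]: "k \<in> borel_measurable borel" and k: "\<And>h. cmod (k h) = 1" for k
  proof (rule lborel_pair.Fubini_integrable)
    show "(\<lambda>(x, h). k h * (f (x + h) * cnj (f x))) \<in> borel_measurable (lborel \<Otimes>\<^sub>M lborel)"
      by measurable
    have "(LINT h|lborel. cmod (f (x + h))) = (LINT h|lborel. cmod (f h))" for x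
      using lborel_integral_translate[of "\<lambda>h. cmod (f h)" x] by (simp add: add.commute)
    then show "integrable lborel (\<lambda>x. LINT h|lborel. norm (case (x, h) of (x, h) \<Rightarrow> k h * (f (x + h) * cnj (f x))))"
      using f by (simp add: norm_mult k)
    show "AE x in lborel. integrable lborel (\<lambda>h. case (x, h) of (x, h) \<Rightarrow> k h * (f (x + h) * cnj (f x)))"
    proof (rule AE_I2)
      fix x
      have "integrable lborel (\<lambda>h. f (x + h) * cnj (f x))"
        using lborel_integrable_translate[OF f, of x] by (simp add: add.commute)
      then show "integrable lborel (\<lambda>h. case (x, h) of (x, h) \<Rightarrow> k h * (f (x + h) * cnj (f x)))"
        by (rule Bochner_Integration.integrable_bound) (auto simp: norm_mult k)
    qed
  qed
  show "integrable lborel (autocorrelation f)"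
    using lborel_pair.integrable_snd[OF int[of "\<lambda>_. 1"]] by (simp add: autocorrelation_def[abs_def])
  have "fourier (autocorrelation f) \<xi>
      = (LINT h|lborel. LINT x|lborel. exp (- (\<i> * of_real (h * \<xi>))) * (f (x + h) * cnj (f x)))"
    by (simp add: fourier_def autocorrelation_def)
  also have "\<dots> = (LINT x|lborel. LINT h|lborel. exp (- (\<i> * of_real (h * \<xi>))) * (f (x + h) * cnj (f x)))"
    by (rule lborel_pair.Fubini_integral[OF int]) (auto simp del: of_real_mult)
  also have "\<dots> = (LINT x|lborel. fourier f \<xi> * (exp (- (\<i> * of_real (x * (- \<xi>)))) * cnj (f x)))"
  proof (rule Bochner_Integration.integral_cong[OF refl])
    fix x
    have "(LINT h|lborel. exp (- (\<i> * of_real (h * \<xi>))) * (f (x + h) * cnj (f x)))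
       = (LINT h|lborel. (exp (- (\<i> * of_real ((h + x) * \<xi>))) * f (h + x))) * (exp (\<i> * of_real (x * \<xi>)) * cnj (f x))"
      by (subst integral_mult_left_zero[symmetric], rule Bochner_Integration.integral_cong[OF refl])
        (simp add: exp_add[symmetric] algebra_simps exp_diff exp_minus)
    also have "(LINT h|lborel. (exp (- (\<i> * of_real ((h + x) * \<xi>))) * f (h + x))) = fourier f \<xi>"
      unfolding fourier_def by (rule lborel_integral_translate)
    finally show "(LINT h|lborel. exp (- (\<i> * of_real (h * \<xi>))) * (f (x + h) * cnj (f x)))
        = fourier f \<xi> * (exp (- (\<i> * of_real (x * (- \<xi>)))) * cnj (f x))" by simp
  qed
  also have "\<dots> = fourier f \<xi> * fourier (\<lambda>x. cnj (f x)) (- \<xi>)"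
    unfolding fourier_def by simp
  also have "\<dots> = of_real ((cmod (fourier f \<xi>))\<^sup>2)"
    unfolding fourier_cnj minus_minus by (rule complex_norm_square[symmetric])
  finally show "fourier (autocorrelation f) \<xi> = of_real ((cmod (fourier f \<xi>))\<^sup>2)" .
qed

text \<open>
  Split the factor \<open>cnj (f x)\<close> at height \<open>N\<close>. The bounded part meets the \<open>L\<^sup>1\<close> continuity of
  translations; the part above \<open>N\<close> is small in \<open>L\<^sup>2\<close> uniformly in the translation.
\<close>

lemma autocorrelation_tendsto:
  assumes f1: "integrable lborel f" and f2: "square_integrable f" and X: "X \<longlonglongrightarrow> 0"
  shows "(\<lambda>n. autocorrelation f (X n)) \<longlonglongrightarrow> autocorrelation f 0"
proof -
  note [measurable] = borel_measurable_integrable[OF f1]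
  define g where "g N x = (if cmod (f x) \<le> real N then f x else 0)" for N x
  have [measurable]: "\<And>N. g N \<in> borel_measurable lborel" unfolding g_def[abs_def] by measurable
  have g2: "square_integrable (g N)" for N
    by (rule square_integrable_mono[OF f2, where C = 1]) (auto simp: g_def)
  have bound: "cmod (autocorrelation f h - autocorrelation f 0)
     \<le> real N * (LINT x|lborel. cmod (f (x + h) - f x)) + 2 * L2_norm f * L2_norm (\<lambda>x. f x - g N x)" for h N
  proof -
    define d where "d x = f (x + h) - f x" for x
    have d2: "square_integrable d"
      unfolding d_def[abs_def] by (intro square_integrable_diff square_integrable_translate f2)
    have d1: "integrable lborel d"
      unfolding d_def[abs_def] by (intro Bochner_Integration.integrable_diff lborel_integrable_translate f1)
    have dn: "L2_norm d \<le> 2 * L2_norm f"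
      using L2_norm_triangle_diff[OF square_integrable_translate[OF f2] f2, of h]
      by (simp add: d_def[abs_def] L2_norm_translate)
    have fg2: "square_integrable (\<lambda>x. f x - g N x)" by (intro square_integrable_diff f2 g2)
    note cnj2 = square_integrable_cnj[OF fg2] square_integrable_cnj[OF g2, of N] square_integrable_cnj[OF f2]
    note i = L2_Cauchy_Schwarz(1)[OF d2 cnj2(2)] L2_Cauchy_Schwarz(1)[OF d2 cnj2(1)]
    have "autocorrelation f h - autocorrelation f 0
       = (LINT x|lborel. f (x + h) * cnj (f x) - f x * cnj (f x))"
      unfolding autocorrelation_def
      using L2_Cauchy_Schwarz(1)[OF square_integrable_translate[OF f2] cnj2(3), of h]
        L2_Cauchy_Schwarz(1)[OF f2 cnj2(3)] by simp
    also have "\<dots> = (LINT x|lborel. d x * cnj (g N x) + d x * cnj (f x - g N x))"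
      by (rule Bochner_Integration.integral_cong) (auto simp: d_def algebra_simps)
    also have "\<dots> = (LINT x|lborel. d x * cnj (g N x)) + (LINT x|lborel. d x * cnj (f x - g N x))"
      using i by (rule Bochner_Integration.integral_add)
    finally have "cmod (autocorrelation f h - autocorrelation f 0)
       \<le> cmod (LINT x|lborel. d x * cnj (g N x)) + cmod (LINT x|lborel. d x * cnj (f x - g N x))"
      using norm_triangle_ineq by metis
    also have "cmod (LINT x|lborel. d x * cnj (g N x)) \<le> (LINT x|lborel. real N * cmod (d x))"
    proof (rule Bochner_Integration.integral_norm_bound_integral[OF i(1)])
      fix x
      have "cmod (g N x) \<le> real N" by (simp add: g_def)
      then show "cmod (d x * cnj (g N x)) \<le> real N * cmod (d x)"
        unfolding norm_mult complex_mod_cnj by (metis mult.commute mult_right_mono norm_ge_zero)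
    qed (use d1 in auto)
    also have "\<dots> = real N * (LINT x|lborel. cmod (d x))" by simp
    also have "cmod (LINT x|lborel. d x * cnj (f x - g N x)) \<le> L2_norm d * L2_norm (\<lambda>x. f x - g N x)"
      using L2_Cauchy_Schwarz(2)[OF d2 cnj2(1)] by (simp only: L2_norm_cnj)
    also have "\<dots> \<le> 2 * L2_norm f * L2_norm (\<lambda>x. f x - g N x)"
      by (rule mult_right_mono[OF dn]) simp
    finally show ?thesis by (simp add: d_def)
  qed
  have trunc: "(\<lambda>N. L2_norm (\<lambda>x. f x - g N x)) \<longlonglongrightarrow> 0"
  proof -
    have "(\<lambda>N. LINT x|lborel. (cmod (f x - g N x))\<^sup>2) \<longlonglongrightarrow> (LINT x|(lborel::real measure). 0::real)"
    proof (rule integral_dominated_convergence)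
      show "integrable lborel (\<lambda>x. (cmod (f x))\<^sup>2)" using f2 by (simp add: square_integrable_def)
      show "AE x in lborel. (\<lambda>N. (cmod (f x - g N x))\<^sup>2) \<longlonglongrightarrow> 0"
      proof (rule AE_I2)
        fix x
        obtain M :: nat where "cmod (f x) \<le> real M" using real_arch_simple by blast
        then have "eventually (\<lambda>N. (cmod (f x - g N x))\<^sup>2 = 0) sequentially"
          by (intro eventually_sequentiallyI[of M]) (auto simp: g_def)
        then show "(\<lambda>N. (cmod (f x - g N x))\<^sup>2) \<longlonglongrightarrow> 0" by (rule tendsto_eventually)
      qed
      show "AE x in lborel. norm ((cmod (f x - g N x))\<^sup>2) \<le> (cmod (f x))\<^sup>2" for N
        by (rule AE_I2) (auto simp: g_def)
    qed auto
    then have "(\<lambda>N. (L2_norm (\<lambda>x. f x - g N x))\<^sup>2) \<longlonglongrightarrow> 0" by (simp add: L2_norm_sq)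
    from tendsto_real_sqrt[OF this] show ?thesis by simp
  qed
  show ?thesis
  proof (rule LIMSEQ_I)
    fix e :: real assume e: "e > 0"
    have "(\<lambda>N. 2 * L2_norm f * L2_norm (\<lambda>x. f x - g N x)) \<longlonglongrightarrow> 0"
      using tendsto_mult_left[OF trunc, of "2 * L2_norm f"] by simp
    from LIMSEQ_D[OF this, of "e/2"] e obtain N
      where N: "2 * L2_norm f * L2_norm (\<lambda>x. f x - g N x) < e/2" by auto
    have "(\<lambda>n. real N * (LINT x|lborel. cmod (f (x + X n) - f x))) \<longlonglongrightarrow> 0"
      using tendsto_mult_left[OF L1_translation_continuous[OF f1 X], of "real N"] by simp
    from LIMSEQ_D[OF this, of "e/2"] e obtain M
      where M: "\<And>n. n \<ge> M \<Longrightarrow> real N * (LINT x|lborel. cmod (f (x + X n) - f x)) < e/2"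
      by auto
    show "\<exists>M. \<forall>n\<ge>M. norm (autocorrelation f (X n) - autocorrelation f 0) < e"
    proof (intro exI allI impI)
      fix n assume "n \<ge> M"
      from M[OF this] N bound[of "X n" N] show "norm (autocorrelation f (X n) - autocorrelation f 0) < e"
        by linarith
    qed
  qed
qed

text \<open>
  The multiplication formula moves the Gaussian onto the autocorrelation, where it becomes an
  approximate identity; continuity at the origin gives the limit.
\<close>

lemma gaussian_average_tendsto:
  assumes f1: "integrable lborel f" and f2: "square_integrable f"
  shows "(\<lambda>n. LINT \<xi>|lborel. of_real ((cmod (fourier f \<xi>))\<^sup>2) * complex_of_real (exp (- (\<xi> / real (Suc n))\<^sup>2 / 2)))
      \<longlonglongrightarrow> of_real (2 * pi * (L2_norm f)\<^sup>2)"
proof -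
  note [measurable] = borel_measurable_integrable[OF f1]
  have gauss: "integrable lborel (\<lambda>z. exp (- z\<^sup>2 / 2) :: real)"
    "(LINT z|lborel. exp (- z\<^sup>2 / 2)) = sqrt (2 * pi)"
  proof -
    have *: "exp (- z\<^sup>2 / 2) = sqrt (2 * pi) * std_normal_density z" for z :: real
      by (simp add: std_normal_density_def)
    show "integrable lborel (\<lambda>z. exp (- z\<^sup>2 / 2) :: real)" "(LINT z|lborel. exp (- z\<^sup>2 / 2)) = sqrt (2 * pi)"
      unfolding * by simp_all
  qed
  have scaled: "integrable lborel (\<lambda>\<xi>. complex_of_real (exp (- (\<xi> / n)\<^sup>2 / 2)))" if "n > 0" for n :: real
  proof -
    have "integrable lborel (\<lambda>\<xi>. exp (- (0 + (1 / n) * \<xi>)\<^sup>2 / 2) :: real)"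
      using that by (intro lborel_integrable_real_affine gauss) simp
    then show ?thesis by (intro integrable_of_real) simp
  qed
  have eq: "(LINT \<xi>|lborel. of_real ((cmod (fourier f \<xi>))\<^sup>2) * complex_of_real (exp (- (\<xi> / n)\<^sup>2 / 2)))
     = (LINT z|lborel. autocorrelation f (z / n) * of_real (sqrt (2 * pi) * exp (- z\<^sup>2 / 2)))" if n: "n > 0" for n
  proof -
    have "(LINT \<xi>|lborel. of_real ((cmod (fourier f \<xi>))\<^sup>2) * complex_of_real (exp (- (\<xi> / n)\<^sup>2 / 2)))
      = (LINT x|lborel. autocorrelation f x * of_real (n * sqrt (2 * pi) * exp (- (n * x)\<^sup>2 / 2)))"
      using fourier_multiplication_formula[OF fourier_autocorrelation(1)[OF f1] scaled[OF n]]
      by (simp only: fourier_autocorrelation(2)[OF f1] fourier_gaussian[OF n])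
    also have "\<dots> = \<bar>1 / n\<bar> *\<^sub>R (LINT z|lborel. autocorrelation f (0 + (1 / n) * z)
        * of_real (n * sqrt (2 * pi) * exp (- (n * (0 + (1 / n) * z))\<^sup>2 / 2)))"
      using n by (intro lborel_integral_real_affine) simp
    also have "\<dots> = (LINT z|lborel. \<bar>1 / n\<bar> *\<^sub>R (autocorrelation f (0 + (1 / n) * z)
        * of_real (n * sqrt (2 * pi) * exp (- (n * (0 + (1 / n) * z))\<^sup>2 / 2))))"
      by simp
    also have "\<dots> = (LINT z|lborel. autocorrelation f (z / n) * of_real (sqrt (2 * pi) * exp (- z\<^sup>2 / 2)))"
      using n by (intro Bochner_Integration.integral_cong) (auto simp: scaleR_conv_of_real)
    finally show ?thesis .
  qed
  have "(\<lambda>n. LINT z|lborel. autocorrelation f (z / real (Suc n)) * of_real (sqrt (2 * pi) * exp (- z\<^sup>2 / 2)))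
     \<longlonglongrightarrow> (LINT z|lborel. autocorrelation f 0 * of_real (sqrt (2 * pi) * exp (- z\<^sup>2 / 2)))"
  proof (rule integral_dominated_convergence)
    show "integrable lborel (\<lambda>z. (L2_norm f)\<^sup>2 * (sqrt (2 * pi) * exp (- z\<^sup>2 / 2)))"
      using gauss(1) by (intro integrable_mult_right)
    show "AE z in lborel. (\<lambda>n. autocorrelation f (z / real (Suc n)) * of_real (sqrt (2 * pi) * exp (- z\<^sup>2 / 2)))
       \<longlonglongrightarrow> autocorrelation f 0 * of_real (sqrt (2 * pi) * exp (- z\<^sup>2 / 2))"
    proof (rule AE_I2)
      fix z :: real
      have "(\<lambda>n. z / real (Suc n)) \<longlonglongrightarrow> 0"
        using tendsto_mult_left[OF LIMSEQ_inverse_real_of_nat, of z] by (simp add: divide_inverse)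
      from autocorrelation_tendsto[OF f1 f2 this]
      show "(\<lambda>n. autocorrelation f (z / real (Suc n)) * of_real (sqrt (2 * pi) * exp (- z\<^sup>2 / 2)))
       \<longlonglongrightarrow> autocorrelation f 0 * of_real (sqrt (2 * pi) * exp (- z\<^sup>2 / 2))" by (rule tendsto_mult_right)
    qed
    show "AE z in lborel. norm (autocorrelation f (z / real (Suc n)) * of_real (sqrt (2 * pi) * exp (- z\<^sup>2 / 2)))
       \<le> (L2_norm f)\<^sup>2 * (sqrt (2 * pi) * exp (- z\<^sup>2 / 2))" for n
    proof (rule AE_I2)
      fix z :: real
      show "norm (autocorrelation f (z / real (Suc n)) * of_real (sqrt (2 * pi) * exp (- z\<^sup>2 / 2)))
       \<le> (L2_norm f)\<^sup>2 * (sqrt (2 * pi) * exp (- z\<^sup>2 / 2))"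
        unfolding norm_mult norm_of_real
        using cmod_autocorrelation_le[OF f2, of "z / real (Suc n)"]
        by (simp add: mult_right_mono del: of_nat_Suc)
    qed
  qed measurable
  also have "(LINT z|lborel. autocorrelation f 0 * of_real (sqrt (2 * pi) * exp (- z\<^sup>2 / 2)))
      = autocorrelation f 0 * of_real (LINT z|lborel. sqrt (2 * pi) * exp (- z\<^sup>2 / 2))"
    by (simp only: integral_mult_right_zero integral_complex_of_real)
  also have "\<dots> = of_real (2 * pi * (L2_norm f)\<^sup>2)"
    unfolding integral_mult_right_zero gauss(2) autocorrelation_0
    by (simp add: of_real_mult[symmetric] of_real_power[symmetric] mult.commute
        del: of_real_mult of_real_power)
  finally show ?thesis by (subst eq) simp_all
qed

text \<open>
  The Gaussian weights increase to \<open>1\<close>. Fatou's lemma first shows that the transform is square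
  integrable; with that known, dominated convergence identifies its norm.
\<close>

theorem Plancherel:
  assumes f1: "integrable lborel f" and f2: "square_integrable f"
  shows "square_integrable (fourier f)" and "L2_norm (fourier f) = sqrt (2 * pi) * L2_norm f"
proof -
  note [measurable] = borel_measurable_integrable[OF f1]
  define \<gamma> where "\<gamma> n \<xi> = exp (- (\<xi> / real (Suc n))\<^sup>2 / 2)" for n \<xi>
  define F where "F \<xi> = (cmod (fourier f \<xi>))\<^sup>2" for \<xi>
  have [measurable]: "\<And>n. \<gamma> n \<in> borel_measurable borel" "F \<in> borel_measurable borel"
    unfolding \<gamma>_def[abs_def] F_def[abs_def] by measurable
  have \<gamma>1: "0 \<le> \<gamma> n \<xi>" "\<gamma> n \<xi> \<le> 1" for n \<xi> by (simp_all add: \<gamma>_def)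
  have \<gamma>lim: "(\<lambda>n. F \<xi> * \<gamma> n \<xi>) \<longlonglongrightarrow> F \<xi>" for \<xi>
  proof -
    have "(\<lambda>n. \<xi> / real (Suc n)) \<longlonglongrightarrow> 0"
      using tendsto_mult_left[OF LIMSEQ_inverse_real_of_nat, of \<xi>] by (simp add: divide_inverse)
    then have "(\<lambda>n. F \<xi> * exp (- (\<xi> / real (Suc n))\<^sup>2 / 2)) \<longlonglongrightarrow> F \<xi> * exp (- 0\<^sup>2 / 2)"
      by (intro tendsto_intros) auto
    then show ?thesis by (simp add: \<gamma>_def)
  qed
  have lim: "(\<lambda>n. LINT \<xi>|lborel. F \<xi> * \<gamma> n \<xi>) \<longlonglongrightarrow> 2 * pi * (L2_norm f)\<^sup>2"
  proof -
    have "(\<lambda>n. complex_of_real (LINT \<xi>|lborel. F \<xi> * \<gamma> n \<xi>)) \<longlonglongrightarrow> of_real (2 * pi * (L2_norm f)\<^sup>2)"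
      using gaussian_average_tendsto[OF f1 f2]
      unfolding F_def[symmetric] \<gamma>_def[symmetric] of_real_mult[symmetric] integral_complex_of_real .
    then show ?thesis by (simp only: tendsto_of_real_iff)
  qed
  have iFg: "integrable lborel (\<lambda>\<xi>. F \<xi> * \<gamma> n \<xi>)" for n
  proof -
    have *: "\<gamma> n \<xi> = (sqrt (2 * pi) * real (Suc n)) * normal_density 0 (real (Suc n)) \<xi>" for \<xi>
      by (simp add: \<gamma>_def normal_density_def power_divide real_sqrt_mult del: of_nat_Suc)
    have "integrable lborel (\<gamma> n)" unfolding *[abs_def] by (intro integrable_mult_right) auto
    then have "integrable lborel (\<lambda>\<xi>. (LINT x|lborel. cmod (f x))\<^sup>2 * \<gamma> n \<xi>)"
      by (intro integrable_mult_right)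
    then show ?thesis
    proof (rule Bochner_Integration.integrable_bound)
      have "norm (F \<xi> * \<gamma> n \<xi>) \<le> norm ((LINT x|lborel. cmod (f x))\<^sup>2 * \<gamma> n \<xi>)" for \<xi>
        using cmod_fourier_le[of f \<xi>] by (auto simp: F_def \<gamma>1 abs_mult intro!: mult_right_mono power_mono)
      then show "AE \<xi> in lborel. norm (F \<xi> * \<gamma> n \<xi>) \<le> norm ((LINT x|lborel. cmod (f x))\<^sup>2 * \<gamma> n \<xi>)"
        by simp
    qed measurable
  qed
  have "(\<integral>\<^sup>+\<xi>. ennreal (F \<xi>) \<partial>lborel) = (\<integral>\<^sup>+\<xi>. liminf (\<lambda>n. ennreal (F \<xi> * \<gamma> n \<xi>)) \<partial>lborel)"
  proof (rule nn_integral_cong)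
    fix \<xi>
    have "(\<lambda>n. ennreal (F \<xi> * \<gamma> n \<xi>)) \<longlonglongrightarrow> ennreal (F \<xi>)"
      using \<gamma>lim by (rule tendsto_ennrealI)
    then show "ennreal (F \<xi>) = liminf (\<lambda>n. ennreal (F \<xi> * \<gamma> n \<xi>))"
      by (intro lim_imp_Liminf[symmetric] trivial_limit_sequentially)
  qed
  also have "\<dots> \<le> liminf (\<lambda>n. \<integral>\<^sup>+\<xi>. ennreal (F \<xi> * \<gamma> n \<xi>) \<partial>lborel)"
    by (rule nn_integral_liminf) measurable
  also have "\<dots> = liminf (\<lambda>n. ennreal (LINT \<xi>|lborel. F \<xi> * \<gamma> n \<xi>))"
    by (subst nn_integral_eq_integral[OF iFg]) (auto simp: F_def \<gamma>1)
  also have "\<dots> = ennreal (2 * pi * (L2_norm f)\<^sup>2)"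
    using tendsto_ennrealI[OF lim] by (intro lim_imp_Liminf trivial_limit_sequentially)
  finally have "(\<integral>\<^sup>+\<xi>. ennreal ((cmod (fourier f \<xi>))\<^sup>2) \<partial>lborel) \<le> ennreal ((sqrt (2 * pi) * L2_norm f)\<^sup>2)"
    by (simp add: F_def power_mult_distrib)
  then show sq: "square_integrable (fourier f)"
    by (intro square_integrable_bounded_nn_integral(1)) auto
  have "(\<lambda>n. LINT \<xi>|lborel. F \<xi> * \<gamma> n \<xi>) \<longlonglongrightarrow> (LINT \<xi>|lborel. F \<xi>)"
  proof (rule integral_dominated_convergence)
    show "integrable lborel F" using sq by (simp add: F_def[abs_def] square_integrable_def)
    show "AE \<xi> in lborel. norm (F \<xi> * \<gamma> n \<xi>) \<le> F \<xi>" for n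
      using \<gamma>1 by (auto simp: F_def abs_mult mult_left_le)
  qed (use \<gamma>lim in auto)
  from LIMSEQ_unique[OF this lim] have "(L2_norm (fourier f))\<^sup>2 = (sqrt (2 * pi) * L2_norm f)\<^sup>2"
    by (simp add: F_def L2_norm_sq power_mult_distrib)
  then show "L2_norm (fourier f) = sqrt (2 * pi) * L2_norm f"
    by (simp add: power2_eq_iff_nonneg)
qed

section \<open>The Fourier transform of a square integrable function\<close>

lemma Plancherel_truncation:
  assumes "square_integrable f"
  shows "square_integrable (fourier (\<lambda>x. indicator {-R..R} x * f x))"
    and "L2_norm (fourier (\<lambda>x. indicator {-R..R} x * f x))
       = sqrt (2 * pi) * L2_norm (\<lambda>x. indicator {-R..R} x * f x)"
  by (intro Plancherel L2_truncation_integrable square_integrable_indicator assms; simp)+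

lemma L2_norm_truncation_tendsto:
  assumes "square_integrable f"
  shows "((\<lambda>R. L2_norm (\<lambda>x. indicator {-R..R} x * f x)) \<longlongrightarrow> L2_norm f) at_top"
  by (rule L2_norm_tendsto[OF _ assms L2_truncation_tendsto[OF assms]])
    (simp add: square_integrable_indicator assms)

text \<open>
  Plancherel's theorem holds for the truncations, which are integrable, and both sides pass to the
  limit.
\<close>

theorem has_fourier_L2_norm:
  assumes "has_fourier_L2 f g"
  shows "L2_norm g = sqrt (2 * pi) * L2_norm f"
proof -
  have f: "square_integrable f" and g: "square_integrable g"
    and lim: "((\<lambda>R. L2_norm (\<lambda>\<xi>. fourier (\<lambda>x. indicator {-R..R} x * f x) \<xi> - g \<xi>)) \<longlongrightarrow> 0) at_top"
    using assms by (auto simp: has_fourier_L2_def)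
  have "((\<lambda>R. L2_norm (fourier (\<lambda>x. indicator {-R..R} x * f x))) \<longlongrightarrow> L2_norm g) at_top"
    by (rule L2_norm_tendsto[OF Plancherel_truncation(1)[OF f] g lim])
  moreover have "((\<lambda>R. L2_norm (fourier (\<lambda>x. indicator {-R..R} x * f x))) \<longlongrightarrow> sqrt (2 * pi) * L2_norm f) at_top"
    unfolding Plancherel_truncation(2)[OF f]
    by (intro tendsto_mult_left L2_norm_truncation_tendsto f)
  ultimately show ?thesis by (rule tendsto_unique[OF trivial_limit_at_top_linorder])
qed

lemma L2_norm_reflect: "L2_norm (\<lambda>x. f (- x)) = L2_norm f"
  using lborel_integral_real_affine[of "-1" "\<lambda>x. (cmod (f x))\<^sup>2" 0] by (simp add: L2_norm_def)

lemma square_integrable_reflect: "square_integrable f \<Longrightarrow> square_integrable (\<lambda>x. f (- x))"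
  using lborel_integrable_real_affine[of "\<lambda>x. (cmod (f x))\<^sup>2" "-1" 0]
  by (auto simp: square_integrable_def)

text \<open>
  The preimage \<open>f\<close> is the \<open>L\<^sup>2\<close> limit of the inverse transforms \<open>fn n\<close> of the truncations \<open>gn n\<close> of
  \<open>g\<close>, which form a Cauchy sequence by Plancherel's theorem. What has to be shown is that the
  transforms of the truncations \<open>fR R\<close> of \<open>f\<close> converge to \<open>g\<close>. The multiplication formula gives
  their inner product with \<open>gn n\<close>, and in the limit \<open>n \<rightarrow> \<infinity>\<close> their inner product with \<open>g\<close>, which
  turns out to be \<open>2 \<pi>\<close> times the squared norm of \<open>fR R\<close>, that is, their own squared norm. So the
  squared distance to \<open>g\<close> is the squared norm of \<open>g\<close> minus \<open>2 \<pi>\<close> times the squared norm of \<open>fR R\<close>,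
  and this tends to zero because the norms of \<open>f\<close> and \<open>g\<close> match.
\<close>

theorem has_fourier_L2_surj:
  assumes g: "square_integrable g"
  shows "\<exists>f. has_fourier_L2 f g"
proof -
  define gn where "gn n \<xi> = indicator {- real n..real n} \<xi> * g \<xi>" for n \<xi>
  define fn where "fn n x = of_real (1 / (2 * pi)) * fourier (gn n) (- x)" for n x
  have gn1: "integrable lborel (gn n)" and gn2: "square_integrable (gn n)" for n
    unfolding gn_def[abs_def] by (intro L2_truncation_integrable square_integrable_indicator g; simp)+
  have fn2: "square_integrable (fn n)" for n
    unfolding fn_def[abs_def]
    by (intro square_integrable_cmult square_integrable_reflect[of "fourier (gn n)"] Plancherel gn1 gn2)
  have gn_lim: "(\<lambda>n. L2_norm (\<lambda>\<xi>. gn n \<xi> - g \<xi>)) \<longlonglongrightarrow> 0"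
    unfolding gn_def by (rule filterlim_compose[OF L2_truncation_tendsto[OF g] filterlim_real_sequentially])
  have pi2: "cmod (of_real (1 / (2 * pi))) * sqrt (2 * pi) = 1 / sqrt (2 * pi)"
    unfolding norm_of_real by (simp add: real_sqrt_mult field_simps)
  have fn_norm: "L2_norm (fn n) = 1 / sqrt (2 * pi) * L2_norm (gn n)" for n
    unfolding fn_def[abs_def] L2_norm_cmult L2_norm_reflect[of "fourier (gn n)"] Plancherel(2)[OF gn1 gn2] pi2[symmetric]
    by simp
  have fn_diff: "L2_norm (\<lambda>x. fn m x - fn n x) = 1 / sqrt (2 * pi) * L2_norm (\<lambda>\<xi>. gn m \<xi> - gn n \<xi>)" for m n
  proof -
    have "fn m x - fn n x = of_real (1 / (2 * pi)) * fourier (\<lambda>\<xi>. gn m \<xi> - gn n \<xi>) (- x)" for x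
      by (simp add: fn_def fourier_diff[OF gn1 gn1] right_diff_distrib)
    then have "L2_norm (\<lambda>x. fn m x - fn n x)
        = L2_norm (\<lambda>x. of_real (1 / (2 * pi)) * fourier (\<lambda>\<xi>. gn m \<xi> - gn n \<xi>) (- x))"
      by (simp only:)
    also have "\<dots> = cmod (of_real (1 / (2 * pi))) * (sqrt (2 * pi) * L2_norm (\<lambda>\<xi>. gn m \<xi> - gn n \<xi>))"
      unfolding L2_norm_cmult L2_norm_reflect[of "fourier (\<lambda>\<xi>. gn m \<xi> - gn n \<xi>)"]
      by (subst Plancherel(2)) (intro Bochner_Integration.integrable_diff square_integrable_diff gn1 gn2 refl)+
    finally show ?thesis by (simp only: mult.assoc[symmetric] pi2)
  qed
  have "\<exists>N. \<forall>m\<ge>N. \<forall>n\<ge>N. L2_norm (\<lambda>x. fn m x - fn n x) < e" if e: "e > 0" for e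
  proof -
    have "e * sqrt (2 * pi) / 2 > 0" using e by simp
    from LIMSEQ_D[OF gn_lim this] obtain N
      where N: "\<And>n. n \<ge> N \<Longrightarrow> L2_norm (\<lambda>\<xi>. gn n \<xi> - g \<xi>) < e * sqrt (2 * pi) / 2" by auto
    show ?thesis
    proof (intro exI allI impI)
      fix m n assume mn: "m \<ge> N" "n \<ge> N"
      have "L2_norm (\<lambda>\<xi>. gn m \<xi> - gn n \<xi>) < e * sqrt (2 * pi)"
        using L2_norm_triangle_mid[OF gn2 g gn2, of m n] N[OF mn(1)] N[OF mn(2)]
        by (simp add: L2_norm_minus_commute[of g])
      then show "L2_norm (\<lambda>x. fn m x - fn n x) < e"
        unfolding fn_diff by (simp add: field_simps)
    qed
  qed
  from Riesz_Fischer[OF fn2 this] obtain f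
    where f: "square_integrable f" and f_lim: "(\<lambda>n. L2_norm (\<lambda>x. fn n x - f x)) \<longlonglongrightarrow> 0" by blast
  have f_norm: "2 * pi * (L2_norm f)\<^sup>2 = (L2_norm g)\<^sup>2"
  proof -
    have "(\<lambda>n. L2_norm (fn n)) \<longlonglongrightarrow> 1 / sqrt (2 * pi) * L2_norm g"
      unfolding fn_norm by (intro tendsto_mult_left L2_norm_tendsto gn2 g gn_lim)
    moreover have "(\<lambda>n. L2_norm (fn n)) \<longlonglongrightarrow> L2_norm f"
      by (intro L2_norm_tendsto fn2 f f_lim)
    ultimately have "L2_norm f = 1 / sqrt (2 * pi) * L2_norm g"
      by (rule LIMSEQ_unique[symmetric])
    then show ?thesis by (simp add: power_mult_distrib power_divide)
  qed
  define fR where "fR R x = indicator {-R..R} x * f x" for R x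
  have fR1: "integrable lborel (fR R)" and fR2: "square_integrable (fR R)" for R
    unfolding fR_def[abs_def] by (intro L2_truncation_integrable square_integrable_indicator f; simp)+
  note F = Plancherel[OF fR1 fR2]
  have inner: "(LINT \<xi>|lborel. fourier (fR R) \<xi> * cnj (g \<xi>)) = of_real (2 * pi * (L2_norm (fR R))\<^sup>2)" for R
  proof -
    have "(LINT \<xi>|lborel. fourier (fR R) \<xi> * cnj (gn n \<xi>)) = of_real (2 * pi) * (LINT x|lborel. fR R x * cnj (fn n x))" for n
    proof -
      have "fR R x * fourier (\<lambda>\<xi>. cnj (gn n \<xi>)) x = of_real (2 * pi) * (fR R x * cnj (fn n x))" for x
        unfolding fourier_cnj fn_def by simp
      then show ?thesis
        unfolding fourier_multiplication_formula[OF fR1 integrable_cnj[OF gn1]]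
        by (simp only: integral_mult_right_zero)
    qed
    then have lim1: "(\<lambda>n. of_real (2 * pi) * (LINT x|lborel. fR R x * cnj (fn n x)))
        \<longlonglongrightarrow> (LINT \<xi>|lborel. fourier (fR R) \<xi> * cnj (g \<xi>))"
      using L2_inner_tendsto[OF F(1) gn2 g gn_lim, of R] by (simp only:)
    have lim2: "(\<lambda>n. of_real (2 * pi) * (LINT x|lborel. fR R x * cnj (fn n x)))
        \<longlonglongrightarrow> of_real (2 * pi) * (LINT x|lborel. fR R x * cnj (f x))"
      by (intro tendsto_mult_left L2_inner_tendsto fR2 fn2 f f_lim)
    have "(LINT x|lborel. fR R x * cnj (f x)) = of_real ((L2_norm (fR R))\<^sup>2)"
    proof -
      have "fR R x * cnj (f x) = of_real ((cmod (fR R x))\<^sup>2)" for x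
        by (simp add: fR_def indicator_def complex_norm_square del: of_real_power)
      then show ?thesis by (simp add: L2_norm_sq del: of_real_power)
    qed
    then show ?thesis using LIMSEQ_unique[OF lim1 lim2] by (simp only: of_real_mult)
  qed
  have "((\<lambda>R. L2_norm (\<lambda>\<xi>. fourier (fR R) \<xi> - g \<xi>)) \<longlongrightarrow> 0) at_top"
  proof -
    have "(L2_norm (\<lambda>\<xi>. fourier (fR R) \<xi> - g \<xi>))\<^sup>2 = (L2_norm g)\<^sup>2 - 2 * pi * (L2_norm (fR R))\<^sup>2" for R
      unfolding L2_norm_diff_sq[OF F(1) g] inner F(2) Re_complex_of_real
      by (simp add: power_mult_distrib)
    moreover have "((\<lambda>R. (L2_norm g)\<^sup>2 - 2 * pi * (L2_norm (fR R))\<^sup>2) \<longlongrightarrow> (L2_norm g)\<^sup>2 - 2 * pi * (L2_norm f)\<^sup>2) at_top"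
      unfolding fR_def by (intro tendsto_intros L2_norm_truncation_tendsto f)
    ultimately have "((\<lambda>R. (L2_norm (\<lambda>\<xi>. fourier (fR R) \<xi> - g \<xi>))\<^sup>2) \<longlongrightarrow> 0) at_top"
      using f_norm by simp
    from tendsto_real_sqrt[OF this] show ?thesis by simp
  qed
  then have "has_fourier_L2 f g" using f g by (simp add: has_fourier_L2_def fR_def[abs_def])
  then show ?thesis by blast
qed

section \<open>The differential equation at a fixed frequency\<close>

lemma linear_differential_inequality:
  fixes L L' :: "real \<Rightarrow> real"
  assumes deriv: "\<And>s. s \<ge> 0 \<Longrightarrow> (L has_real_derivative L' s) (at s within {0..})"
    and ineq: "\<And>s. s \<ge> 0 \<Longrightarrow> L' s \<le> - \<rho> * L s" and t: "t \<ge> 0"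
  shows "L t \<le> exp (- \<rho> * t) * L 0"
proof -
  define M where "M s = exp (\<rho> * s) * L s" for s
  have M: "(M has_real_derivative exp (\<rho> * s) * (\<rho> * L s + L' s)) (at s within {0..})" if "s \<ge> 0" for s
    unfolding M_def by (auto intro!: derivative_eq_intros deriv that simp: algebra_simps)
  have "M t \<le> M 0"
  proof (rule DERIV_nonpos_imp_decreasing_open[OF t])
    fix s :: real assume s: "0 < s" "s < t"
    have "at s within {0..} = at s" using s by (intro at_within_interior) auto
    with M[of s] s have "(M has_real_derivative exp (\<rho> * s) * (\<rho> * L s + L' s)) (at s)" by simp
    moreover have "exp (\<rho> * s) * (\<rho> * L s + L' s) \<le> 0"
      using ineq[of s] s by (simp add: mult_le_0_iff)
    ultimately show "\<exists>y. (M has_real_derivative y) (at s) \<and> y \<le> 0" by blast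
  next
    have "continuous_on {0..} M"
      using M by (intro continuous_on_eq_continuous_within[THEN iffD2] ballI)
        (auto intro: DERIV_continuous)
    then show "continuous_on {0..t} M" by (rule continuous_on_subset) auto
  qed
  then have "exp (- \<rho> * t) * (exp (\<rho> * t) * L t) \<le> exp (- \<rho> * t) * L 0"
    by (simp add: M_def)
  moreover have "exp (- \<rho> * t) * (exp (\<rho> * t) * L t) = L t"
    by (simp add: mult.assoc[symmetric] exp_add[symmetric])
  ultimately show ?thesis by (simp only:)
qed

text \<open>
  The algebra behind the decay when only \<open>w = w1 + \<i> w2\<close> is damped. \<open>E\<close> is the energy,
  \<open>P = Im (y cnj w)\<close>, and the left-hand side of the second claim is the time derivative of
  \<open>E - 2 k P\<close>. The term \<open>- 2 k x \<bar>y\<bar>\<^sup>2\<close> supplies the missing damping of \<open>y\<close>; the choice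
  \<open>k x = r / 4\<close> and the two smallness conditions on \<open>k\<close> keep the other terms produced by the
  correction below the damping of \<open>w\<close>.
\<close>

lemma partially_damped_dissipation_inequality:
  fixes y1 y2 w1 w2 :: real
  assumes "0 \<le> r" "r \<le> \<epsilon>" "k * x = r / 4" "k\<^sup>2 * \<epsilon> \<le> r / 16" "k\<^sup>2 \<le> 1 / 16"
  defines "E \<equiv> y1\<^sup>2 + y2\<^sup>2 + w1\<^sup>2 + w2\<^sup>2" and "P \<equiv> y2 * w1 - y1 * w2"
  shows "\<bar>2 * k * P\<bar> \<le> E / 4"
    and "- 2 * \<epsilon> * (w1\<^sup>2 + w2\<^sup>2) - 2 * k * (x * (y1\<^sup>2 + y2\<^sup>2 - w1\<^sup>2 - w2\<^sup>2) - \<epsilon> * P)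
       \<le> - (r / 4) * (E - 2 * k * P)"
proof -
  have kabs: "\<bar>k\<bar> \<le> 1 / 4"
  proof (rule power2_le_imp_le)
    show "\<bar>k\<bar>\<^sup>2 \<le> (1 / 4)\<^sup>2" using assms(5) by (simp add: power_divide)
  qed simp
  have P2: "2 * \<bar>P\<bar> \<le> E"
  proof -
    have "0 \<le> (y2 - w1)\<^sup>2 + (y1 + w2)\<^sup>2" "0 \<le> (y2 + w1)\<^sup>2 + (y1 - w2)\<^sup>2" by simp_all
    then show ?thesis by (simp add: E_def P_def power2_eq_square algebra_simps abs_if)
  qed
  have "\<bar>k\<bar> * (2 * \<bar>P\<bar>) \<le> 1 / 4 * E"
    by (rule mult_mono[OF kabs P2]) (auto simp: E_def)
  then show kP: "\<bar>2 * k * P\<bar> \<le> E / 4" by (simp add: abs_mult)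
  (* This completes the square in the only cross term of the derivative, 2 k \<epsilon> P. *)
  have "0 \<le> \<epsilon> * ((k * y2 - w1)\<^sup>2 + (k * y1 + w2)\<^sup>2)" using assms(1,2) by simp
  then have cross: "2 * k * \<epsilon> * P \<le> k\<^sup>2 * \<epsilon> * (y1\<^sup>2 + y2\<^sup>2) + \<epsilon> * (w1\<^sup>2 + w2\<^sup>2)"
    by (simp add: P_def power2_eq_square algebra_simps)
  have kE: "k\<^sup>2 * \<epsilon> * (y1\<^sup>2 + y2\<^sup>2) \<le> r / 16 * (y1\<^sup>2 + y2\<^sup>2)"
    using assms(4) by (rule mult_right_mono) simp
  have rw: "r * (w1\<^sup>2 + w2\<^sup>2) \<le> \<epsilon> * (w1\<^sup>2 + w2\<^sup>2)"
    using assms(2) by (rule mult_right_mono) simp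
  have rw0: "0 \<le> r * (w1\<^sup>2 + w2\<^sup>2)" using assms(1) by simp
  have E0: "0 \<le> r * E" using assms(1) by (simp add: E_def)
  have rL: "r * (E - 2 * k * P) \<le> r * (5 / 4 * E)"
    using kP assms(1) by (intro mult_left_mono) auto
  have "- 2 * \<epsilon> * (w1\<^sup>2 + w2\<^sup>2) - 2 * k * (x * (y1\<^sup>2 + y2\<^sup>2 - w1\<^sup>2 - w2\<^sup>2) - \<epsilon> * P)
      = - 2 * \<epsilon> * (w1\<^sup>2 + w2\<^sup>2) - 2 * (k * x) * (y1\<^sup>2 + y2\<^sup>2 - w1\<^sup>2 - w2\<^sup>2) + 2 * k * \<epsilon> * P"
    by (simp add: algebra_simps)
  also have "\<dots> = - 2 * \<epsilon> * (w1\<^sup>2 + w2\<^sup>2) - r / 2 * (y1\<^sup>2 + y2\<^sup>2) + r / 2 * (w1\<^sup>2 + w2\<^sup>2) + 2 * k * \<epsilon> * P"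
    unfolding assms(3) by (simp add: field_simps)
  also have "\<dots> = - 2 * (\<epsilon> * (w1\<^sup>2 + w2\<^sup>2)) - 1 / 2 * (r * (y1\<^sup>2 + y2\<^sup>2)) + 1 / 2 * (r * (w1\<^sup>2 + w2\<^sup>2)) + 2 * k * \<epsilon> * P"
    by simp
  also have "\<dots> \<le> - (7 / 16) * (r * (y1\<^sup>2 + y2\<^sup>2) + r * (w1\<^sup>2 + w2\<^sup>2))"
    using cross kE rw rw0 unfolding times_divide_eq_left by argo
  also have "\<dots> = - (7 / 16) * (r * E)" by (simp add: E_def algebra_simps)
  also have "\<dots> \<le> - (r / 4) * (E - 2 * k * P)"
    using rL E0 by simp
  finally show "- 2 * \<epsilon> * (w1\<^sup>2 + w2\<^sup>2) - 2 * k * (x * (y1\<^sup>2 + y2\<^sup>2 - w1\<^sup>2 - w2\<^sup>2) - \<epsilon> * P)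
       \<le> - (r / 4) * (E - 2 * k * P)" .
qed

text \<open>
  If both components are damped at least at the rate \<open>r\<close>, the energy itself decays. Otherwise \<open>y\<close> is
  undamped and \<open>E - 2 k Im (y cnj w)\<close> with \<open>k = r / (4 x)\<close> is used, which is comparable to \<open>E\<close>. The
  condition \<open>r \<epsilon> \<le> x\<^sup>2\<close> says that the coupling is strong enough to keep up: for strong damping
  \<open>\<epsilon>\<close> the slow eigenvalue of the system is about \<open>x\<^sup>2 / \<epsilon>\<close>.
\<close>

theorem damped_system_decay:
  fixes y w :: "real \<Rightarrow> complex" and x \<alpha> \<epsilon> r :: real
  assumes dy: "\<And>t. t \<ge> 0 \<Longrightarrow>
      (y has_vector_derivative - (\<i> * of_real x) * w t - of_real \<alpha> * y t) (at t within {0..})"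
    and dw: "\<And>t. t \<ge> 0 \<Longrightarrow>
      (w has_vector_derivative - (\<i> * of_real x) * y t - of_real \<epsilon> * w t) (at t within {0..})"
    and r: "0 \<le> r" "r \<le> \<epsilon>" "r \<le> \<alpha> \<or> \<alpha> = 0 \<and> r * \<epsilon> \<le> x\<^sup>2"
    and t: "t \<ge> 0"
  shows "(cmod (y t))\<^sup>2 + (cmod (w t))\<^sup>2 \<le> 2 * exp (- (r / 4) * t) * ((cmod (y 0))\<^sup>2 + (cmod (w 0))\<^sup>2)"
proof -
  define y1 y2 w1 w2 where "y1 s = Re (y s)" and "y2 s = Im (y s)" and "w1 s = Re (w s)" and "w2 s = Im (w s)" for s
  note defs = y1_def y2_def w1_def w2_def
  have d: "(y1 has_real_derivative x * w2 s - \<alpha> * y1 s) (at s within {0..})"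
    "(y2 has_real_derivative - x * w1 s - \<alpha> * y2 s) (at s within {0..})"
    "(w1 has_real_derivative x * y2 s - \<epsilon> * w1 s) (at s within {0..})"
    "(w2 has_real_derivative - x * y1 s - \<epsilon> * w2 s) (at s within {0..})" if "s \<ge> 0" for s
    using bounded_linear.has_vector_derivative[OF bounded_linear_Re dy[OF that]]
      bounded_linear.has_vector_derivative[OF bounded_linear_Im dy[OF that]]
      bounded_linear.has_vector_derivative[OF bounded_linear_Re dw[OF that]]
      bounded_linear.has_vector_derivative[OF bounded_linear_Im dw[OF that]]
    by (simp_all add: defs[abs_def] has_real_derivative_iff_has_vector_derivative algebra_simps)
  define E where "E s = (y1 s)\<^sup>2 + (y2 s)\<^sup>2 + (w1 s)\<^sup>2 + (w2 s)\<^sup>2" for s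
  have Eeq: "(cmod (y s))\<^sup>2 + (cmod (w s))\<^sup>2 = E s" for s by (simp add: E_def defs cmod_power2)
  have E0: "0 \<le> E s" for s by (simp add: E_def)
  show ?thesis unfolding Eeq
  proof (cases "r \<le> \<alpha>")
    case True
    have "E t \<le> exp (- (r / 4) * t) * E 0"
    proof (rule linear_differential_inequality[OF _ _ t])
      fix s :: real assume s: "s \<ge> 0"
      show "(E has_real_derivative - 2 * \<alpha> * ((y1 s)\<^sup>2 + (y2 s)\<^sup>2) - 2 * \<epsilon> * ((w1 s)\<^sup>2 + (w2 s)\<^sup>2)) (at s within {0..})"
        unfolding E_def by (rule derivative_eq_intros d[OF s] refl)+ (simp add: power2_eq_square algebra_simps)
      have "r * ((y1 s)\<^sup>2 + (y2 s)\<^sup>2) \<le> \<alpha> * ((y1 s)\<^sup>2 + (y2 s)\<^sup>2)"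
        "r * ((w1 s)\<^sup>2 + (w2 s)\<^sup>2) \<le> \<epsilon> * ((w1 s)\<^sup>2 + (w2 s)\<^sup>2)"
        using True r(2) by (simp_all add: mult_right_mono)
      moreover have "0 \<le> r * ((y1 s)\<^sup>2 + (y2 s)\<^sup>2)" "0 \<le> r * ((w1 s)\<^sup>2 + (w2 s)\<^sup>2)" using r(1) by simp_all
      ultimately show "- 2 * \<alpha> * ((y1 s)\<^sup>2 + (y2 s)\<^sup>2) - 2 * \<epsilon> * ((w1 s)\<^sup>2 + (w2 s)\<^sup>2) \<le> - (r / 4) * E s"
        unfolding E_def by (simp add: distrib_left)
    qed
    also have "\<dots> \<le> 2 * exp (- (r / 4) * t) * E 0"
      using E0[of 0] by simp
    finally show "E t \<le> 2 * exp (- (r / 4) * t) * E 0" .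
  next
    case False
    then have \<alpha>: "\<alpha> = 0" and rx: "r * \<epsilon> \<le> x\<^sup>2" using r(3) by auto
    have r2: "r\<^sup>2 \<le> x\<^sup>2" using mult_left_mono[OF r(2,1)] rx by (simp add: power2_eq_square)
    (* For x = 0 the hypotheses force r = 0, and the default value k = 0 of the division is right. *)
  define k where "k = r / (4 * x)"
    have k: "k * x = r / 4" "k\<^sup>2 * \<epsilon> \<le> r / 16" "k\<^sup>2 \<le> 1 / 16"
    proof -
      show "k * x = r / 4" using r2 by (cases "x = 0") (auto simp: k_def)
      show "k\<^sup>2 \<le> 1 / 16" using r2 by (cases "x = 0") (auto simp: k_def power_divide power_mult_distrib divide_simps)
      show "k\<^sup>2 * \<epsilon> \<le> r / 16"
      proof (cases "x = 0")
        case False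
        have "k\<^sup>2 * \<epsilon> = r / 16 * (r * \<epsilon> / x\<^sup>2)" by (simp add: k_def power2_eq_square)
        also have "\<dots> \<le> r / 16 * 1" using rx r(1) False by (intro mult_left_mono) auto
        finally show ?thesis by simp
      qed (use r in \<open>auto simp: k_def\<close>)
    qed
    define P where "P s = y2 s * w1 s - y1 s * w2 s" for s
    define L where "L s = E s - 2 * k * P s" for s
    note ineq = partially_damped_dissipation_inequality[OF r(1,2) k]
    have L: "\<bar>L s - E s\<bar> \<le> E s / 4" for s
      using ineq(1)[of "y2 s" "w1 s" "y1 s" "w2 s"] by (simp add: L_def P_def E_def)
    have "L t \<le> exp (- (r / 4) * t) * L 0"
    proof (rule linear_differential_inequality[OF _ _ t])
      fix s :: real assume s: "s \<ge> 0"
      show "(L has_real_derivative - 2 * \<epsilon> * ((w1 s)\<^sup>2 + (w2 s)\<^sup>2)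
           - 2 * k * (x * ((y1 s)\<^sup>2 + (y2 s)\<^sup>2 - (w1 s)\<^sup>2 - (w2 s)\<^sup>2) - \<epsilon> * (y2 s * w1 s - y1 s * w2 s))) (at s within {0..})"
        unfolding L_def E_def P_def
        by (rule derivative_eq_intros d[OF s] refl)+ (simp add: \<alpha> power2_eq_square algebra_simps)
      show "- 2 * \<epsilon> * ((w1 s)\<^sup>2 + (w2 s)\<^sup>2)
           - 2 * k * (x * ((y1 s)\<^sup>2 + (y2 s)\<^sup>2 - (w1 s)\<^sup>2 - (w2 s)\<^sup>2) - \<epsilon> * (y2 s * w1 s - y1 s * w2 s))
           \<le> - (r / 4) * L s"
        unfolding L_def E_def P_def by (rule ineq(2))
    qed
    also have "\<dots> \<le> exp (- (r / 4) * t) * (5 / 4 * E 0)"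
    proof (rule mult_left_mono)
      show "L 0 \<le> 5 / 4 * E 0" using L[of 0] by linarith
    qed simp
    finally have "3 / 4 * E t \<le> exp (- (r / 4) * t) * (5 / 4 * E 0)"
      using L[of t] by linarith
    moreover have "0 \<le> exp (- (r / 4) * t) * E 0" using E0[of 0] by simp
    ultimately show "E t \<le> 2 * exp (- (r / 4) * t) * E 0" by (simp add: field_simps)
  qed
qed

text \<open>
  This is \<open>cosh (t sqrt \<mu>)\<close>, an entire function of \<open>\<mu>\<close>; the real form in each case
  makes measurability in \<open>\<mu>\<close> evident.
\<close>

definition cosh_root :: "real \<Rightarrow> real \<Rightarrow> real" where
  "cosh_root \<mu> t = (if \<mu> > 0 then cosh (sqrt \<mu> * t) else if \<mu> = 0 then 1 else cos (sqrt (- \<mu>) * t))"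

text \<open>
  This is \<open>sinh (t sqrt \<mu>) / sqrt \<mu>\<close>, likewise entire in \<open>\<mu>\<close>.
\<close>

definition sinh_root :: "real \<Rightarrow> real \<Rightarrow> real" where
  "sinh_root \<mu> t = (if \<mu> > 0 then sinh (sqrt \<mu> * t) / sqrt \<mu> else if \<mu> = 0 then t
     else sin (sqrt (- \<mu>) * t) / sqrt (- \<mu>))"

lemma cosh_sinh_root_0 [simp]: "cosh_root \<mu> 0 = 1" "sinh_root \<mu> 0 = 0"
  by (simp_all add: cosh_root_def sinh_root_def)

lemma has_derivative_cosh_root:
  "(cosh_root \<mu> has_real_derivative \<mu> * sinh_root \<mu> t) (at t within A)"
proof -
  consider "\<mu> > 0" | "\<mu> = 0" | "\<mu> < 0" by linarith
  then show ?thesis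
  proof cases
    case 1
    then have "((\<lambda>t. cosh (sqrt \<mu> * t)) has_real_derivative sinh (sqrt \<mu> * t) * sqrt \<mu>) (at t within A)"
      by (auto intro!: derivative_eq_intros)
    moreover have "\<mu> * sinh_root \<mu> t = sinh (sqrt \<mu> * t) * (\<mu> / sqrt \<mu>)"
      using 1 by (simp add: sinh_root_def)
    ultimately show ?thesis using 1 by (simp add: cosh_root_def[abs_def] real_div_sqrt)
  next
    case 3
    then have "((\<lambda>t. cos (sqrt (- \<mu>) * t)) has_real_derivative - sin (sqrt (- \<mu>) * t) * sqrt (- \<mu>)) (at t within A)"
      by (auto intro!: derivative_eq_intros)
    moreover have "\<mu> * sinh_root \<mu> t = - sin (sqrt (- \<mu>) * t) * (- \<mu> / sqrt (- \<mu>))"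
      using 3 by (simp add: sinh_root_def)
    then have "\<mu> * sinh_root \<mu> t = - sin (sqrt (- \<mu>) * t) * sqrt (- \<mu>)"
      using 3 by (simp only: real_div_sqrt)
    ultimately show ?thesis using 3 by (simp add: cosh_root_def[abs_def])
  qed (simp add: cosh_root_def[abs_def] sinh_root_def)
qed

lemma has_derivative_sinh_root:
  "(sinh_root \<mu> has_real_derivative cosh_root \<mu> t) (at t within A)"
proof -
  consider "\<mu> > 0" | "\<mu> = 0" | "\<mu> < 0" by linarith
  then show ?thesis
    by cases (auto simp: cosh_root_def[abs_def] sinh_root_def[abs_def] mult.assoc intro!: derivative_eq_intros)
qed

lemma borel_measurable_cosh_sinh_root [measurable (raw)]:
  assumes [measurable]: "\<mu> \<in> borel_measurable M"
  shows "(\<lambda>\<xi>. cosh_root (\<mu> \<xi>) t) \<in> borel_measurable M"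
    and "(\<lambda>\<xi>. sinh_root (\<mu> \<xi>) t) \<in> borel_measurable M"
  unfolding cosh_root_def sinh_root_def cosh_def sinh_def by measurable

text \<open>
  A component of the matrix exponential that solves the system of \<open>damped_system_decay\<close>: after
  subtraction of \<open>(\<alpha> + \<epsilon>) / 2\<close> times the identity, the matrix of the system has trace zero, and its
  square is \<open>((\<alpha> - \<epsilon>) / 2)\<^sup>2 - x\<^sup>2\<close> times the identity, so its exponential is a combination of the
  identity and the trace-free part. The system is symmetric under exchange of \<open>(y, \<alpha>)\<close> and \<open>(w, \<epsilon>)\<close>, so the same formula
  gives both components.
\<close>

definition damped_component :: "real \<Rightarrow> real \<Rightarrow> real \<Rightarrow> complex \<Rightarrow> complex \<Rightarrow> real \<Rightarrow> complex" where
  "damped_component x \<alpha> \<epsilon> y0 w0 t =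
     (exp (- ((\<alpha> + \<epsilon>) / 2) * t) * cosh_root (((\<alpha> - \<epsilon>) / 2)\<^sup>2 - x\<^sup>2) t) *\<^sub>R y0
   - (exp (- ((\<alpha> + \<epsilon>) / 2) * t) * sinh_root (((\<alpha> - \<epsilon>) / 2)\<^sup>2 - x\<^sup>2) t)
       *\<^sub>R (of_real ((\<alpha> - \<epsilon>) / 2) * y0 + \<i> * of_real x * w0)"

lemma damped_component_0 [simp]: "damped_component x \<alpha> \<epsilon> y0 w0 0 = y0"
  by (simp add: damped_component_def)

lemma damped_component_derivative:
  "(damped_component x \<alpha> \<epsilon> y0 w0 has_vector_derivative
      - (\<i> * of_real x) * damped_component x \<epsilon> \<alpha> w0 y0 t - of_real \<alpha> * damped_component x \<alpha> \<epsilon> y0 w0 t)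
    (at t within A)"
proof -
  define \<tau> \<beta> where "\<tau> = (\<alpha> + \<epsilon>) / 2" and "\<beta> = (\<alpha> - \<epsilon>) / 2"
  define p q where "p t = exp (- \<tau> * t) * cosh_root (\<beta>\<^sup>2 - x\<^sup>2) t"
    and "q t = exp (- \<tau> * t) * sinh_root (\<beta>\<^sup>2 - x\<^sup>2) t" for t
  have y: "damped_component x \<alpha> \<epsilon> y0 w0 t = p t *\<^sub>R y0 - q t *\<^sub>R (of_real \<beta> * y0 + \<i> * of_real x * w0)" for t
    by (simp add: damped_component_def p_def q_def \<tau>_def \<beta>_def)
  have w: "damped_component x \<epsilon> \<alpha> w0 y0 t = p t *\<^sub>R w0 - q t *\<^sub>R (\<i> * of_real x * y0 - of_real \<beta> * w0)" for t
  proof -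
    have "(\<epsilon> + \<alpha>) / 2 = \<tau>" "(\<epsilon> - \<alpha>) / 2 = - \<beta>" by (simp_all add: \<tau>_def \<beta>_def field_simps)
    then show ?thesis by (simp add: damped_component_def p_def q_def)
  qed
  have dp: "(p has_real_derivative - \<tau> * p t + (\<beta>\<^sup>2 - x\<^sup>2) * q t) (at t within A)"
    unfolding p_def q_def
    by (rule derivative_eq_intros has_derivative_cosh_root refl)+ (simp add: algebra_simps)
  have dq: "(q has_real_derivative - \<tau> * q t + p t) (at t within A)"
    unfolding p_def q_def
    by (rule derivative_eq_intros has_derivative_sinh_root refl)+ (simp add: algebra_simps)
  have d: "((\<lambda>t. p t *\<^sub>R u - q t *\<^sub>R v) has_vector_derivative
      (- \<tau> * p t + (\<beta>\<^sup>2 - x\<^sup>2) * q t) *\<^sub>R u - (- \<tau> * q t + p t) *\<^sub>R v) (at t within A)" for u v :: complex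
    using has_vector_derivative_diff[OF has_vector_derivative_scaleR[OF dp has_vector_derivative_const]
        has_vector_derivative_scaleR[OF dq has_vector_derivative_const]] by simp
  have \<alpha>: "\<alpha> = \<tau> + \<beta>" by (simp add: \<tau>_def \<beta>_def field_simps)
  have "(- \<tau> * p t + (\<beta>\<^sup>2 - x\<^sup>2) * q t) *\<^sub>R y0 - (- \<tau> * q t + p t) *\<^sub>R (of_real \<beta> * y0 + \<i> * of_real x * w0)
      = - (\<i> * of_real x) * (p t *\<^sub>R w0 - q t *\<^sub>R (\<i> * of_real x * y0 - of_real \<beta> * w0))
        - of_real (\<tau> + \<beta>) * (p t *\<^sub>R y0 - q t *\<^sub>R (of_real \<beta> * y0 + \<i> * of_real x * w0))"
    by (simp add: scaleR_conv_of_real power2_eq_square algebra_simps)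
  with d[of y0 "of_real \<beta> * y0 + \<i> * of_real x * w0"] show ?thesis
    unfolding y[abs_def] w \<alpha>[symmetric] by simp
qed

lemma borel_measurable_damped_component [measurable (raw)]:
  assumes [measurable]: "x \<in> borel_measurable M" "\<alpha> \<in> borel_measurable M" "\<epsilon> \<in> borel_measurable M"
    "y0 \<in> borel_measurable M" "w0 \<in> borel_measurable M"
  shows "(\<lambda>\<xi>. damped_component (x \<xi>) (\<alpha> \<xi>) (\<epsilon> \<xi>) (y0 \<xi>) (w0 \<xi>) t) \<in> borel_measurable M"
  unfolding damped_component_def by measurable

section \<open>Orders of growth\<close>

text \<open>
  The quotient of two equivalent powers tends both to \<open>1\<close> and, if the exponents were in the wrong
  order, to \<open>0\<close>.
\<close>

lemma has_growth_order_le: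
  assumes "has_growth_order \<kappa> m" "has_growth_order \<kappa> m'"
  shows "m' \<le> m"
proof (rule ccontr)
  assume "\<not> m' \<le> m"
  then have neg: "m - m' < 0" by simp
  from assms obtain C C' where C: "C > 0" "C' > 0"
    and eq: "\<kappa> \<sim>[at_infinity] (\<lambda>\<xi>. C * \<bar>\<xi>\<bar> powr m)" "\<kappa> \<sim>[at_infinity] (\<lambda>\<xi>. C' * \<bar>\<xi>\<bar> powr m')"
    by (auto simp: has_growth_order_def)
  have "(\<lambda>\<xi>. C * \<bar>\<xi>\<bar> powr m) \<sim>[at_infinity] (\<lambda>\<xi>. C' * \<bar>\<xi>\<bar> powr m')"
    using asymp_equiv_trans[OF asymp_equiv_symI[OF eq(1)] eq(2)] .
  then have "(\<lambda>\<xi>. C * \<bar>\<xi>\<bar> powr m) \<sim>[at_top] (\<lambda>\<xi>. C' * \<bar>\<xi>\<bar> powr m')"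
    unfolding asymp_equiv_def by (rule tendsto_mono[OF at_top_le_at_infinity])
  then have "((\<lambda>\<xi>. C * \<bar>\<xi>\<bar> powr m / (C' * \<bar>\<xi>\<bar> powr m')) \<longlongrightarrow> 1) at_top"
    using C by (intro asymp_equivD_strong) (auto intro!: eventually_mono[OF eventually_gt_at_top[of 0]])
  moreover have "eventually (\<lambda>\<xi>. C * \<bar>\<xi>\<bar> powr m / (C' * \<bar>\<xi>\<bar> powr m') = (C / C') * \<xi> powr (m - m')) at_top"
    using eventually_gt_at_top[of 0] by eventually_elim (simp add: powr_diff)
  ultimately have "((\<lambda>\<xi>. (C / C') * \<xi> powr (m - m')) \<longlongrightarrow> 1) at_top"
    using tendsto_cong by fast
  moreover have "((\<lambda>\<xi>. (C / C') * \<xi> powr (m - m')) \<longlongrightarrow> (C / C') * 0) at_top"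
    by (intro tendsto_mult_left tendsto_neg_powr neg filterlim_ident)
  ultimately show False
    using tendsto_unique[OF trivial_limit_at_top_linorder] by fastforce
qed

lemma growth_order_eqI:
  assumes "has_growth_order \<kappa> m"
  shows "growth_order \<kappa> = m"
  unfolding growth_order_def
  by (rule the_equality) (use assms has_growth_order_le in \<open>auto intro: antisym\<close>)

lemma has_growth_orderI:
  assumes "((\<lambda>\<xi>. \<kappa> \<xi> / \<bar>\<xi>\<bar> powr m) \<longlongrightarrow> C) at_infinity" "C > 0"
  shows "has_growth_order \<kappa> m"
  unfolding has_growth_order_def using asymp_equivI'_const[OF assms(1)] assms(2) by auto

lemma square_over_quadratic_tendsto:
  fixes d :: real
  assumes "d > 0"
  shows "((\<lambda>\<xi>. \<xi>\<^sup>2 / (1 + d * \<xi>\<^sup>2)) \<longlongrightarrow> 1 / d) at_infinity"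
proof -
  have "filterlim (\<lambda>\<xi>::real. \<bar>\<xi>\<bar>) at_top at_infinity"
    using filterlim_at_infinity_imp_norm_at_top[OF filterlim_ident[of "at_infinity :: real filter"]]
    by (simp add: real_norm_def[abs_def])
  then have "filterlim (\<lambda>\<xi>::real. \<bar>\<xi>\<bar> * \<bar>\<xi>\<bar>) at_top at_infinity"
    by (intro filterlim_at_top_mult_at_top)
  then have "((\<lambda>\<xi>::real. inverse (\<xi>\<^sup>2)) \<longlongrightarrow> 0) at_infinity"
    by (intro tendsto_inverse_0_at_top) (simp add: power2_eq_square)
  then have "((\<lambda>\<xi>. 1 / (inverse (\<xi>\<^sup>2) + d)) \<longlongrightarrow> 1 / (0 + d)) at_infinity"
    using assms by (intro tendsto_intros) auto
  moreover have "eventually (\<lambda>\<xi>. 1 / (inverse (\<xi>\<^sup>2) + d) = \<xi>\<^sup>2 / (1 + d * \<xi>\<^sup>2)) at_infinity"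
    by (intro eventually_mono[OF eventually_not_equal_at_infinity[of 0]])
       (use assms in \<open>simp add: field_simps add_pos_nonneg\<close>)
  ultimately show ?thesis using tendsto_cong by fastforce
qed

lemma growth_order_epsilon:
  assumes "d \<ge> 0"
  shows "growth_order (epsilon_symbol d) = (if d = 0 then 2 else 0)"
proof (cases "d = 0")
  case True
  have "eventually (\<lambda>\<xi>. epsilon_symbol d \<xi> / \<bar>\<xi>\<bar> powr 2 = 1) at_infinity"
    by (rule eventually_mono[OF eventually_not_equal_at_infinity[of 0]])
       (simp add: epsilon_symbol_def True powr_numeral)
  then have "has_growth_order (epsilon_symbol d) 2"
    by (intro has_growth_orderI[of _ _ 1] tendsto_eventually) auto
  from growth_order_eqI[OF this] True show ?thesis by simp
next
  case False
  with assms have d: "d > 0" by simp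
  have "epsilon_symbol d \<xi> / \<bar>\<xi>\<bar> powr 0 = \<xi>\<^sup>2 / (1 + d * \<xi>\<^sup>2)" for \<xi>
    by (simp add: epsilon_symbol_def)
  then have "has_growth_order (epsilon_symbol d) 0"
    using square_over_quadratic_tendsto[OF d] d by (intro has_growth_orderI[of _ _ "1 / d"]) simp_all
  from growth_order_eqI[OF this] False show ?thesis by simp
qed

text \<open>
  Among the coefficients considered, the hypothesis on the orders excludes only \<open>a = c = 0 < b\<close>, so
  the order of \<open>\<sigma>\<close> is needed in this case alone.
\<close>

lemma growth_order_sigma:
  assumes b: "b > 0" and d: "d \<ge> 0"
  shows "growth_order (sigma_symbol 0 b 0 d) = (if d = 0 then - 1 else - 2)"
proof (cases "d = 0")
  case True
  have "sigma_symbol 0 b 0 d \<xi> / \<bar>\<xi>\<bar> powr - 1 = sqrt (\<xi>\<^sup>2 / (1 + b * \<xi>\<^sup>2))" for \<xi>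
    by (simp add: sigma_symbol_def omega1_def omega2_def True powr_minus real_sqrt_mult divide_inverse)
  then have "has_growth_order (sigma_symbol 0 b 0 d) (- 1)"
    using tendsto_real_sqrt[OF square_over_quadratic_tendsto[OF b]] b
    by (intro has_growth_orderI[of _ _ "sqrt (1 / b)"]) simp_all
  from growth_order_eqI[OF this] True show ?thesis by simp
next
  case False
  with d have d: "d > 0" by simp
  have "sigma_symbol 0 b 0 d \<xi> / \<bar>\<xi>\<bar> powr - 2
      = sqrt (\<xi>\<^sup>2 / (1 + b * \<xi>\<^sup>2) * (\<xi>\<^sup>2 / (1 + d * \<xi>\<^sup>2)))" for \<xi>
    by (simp add: sigma_symbol_def omega1_def omega2_def powr_minus powr_numeral divide_inverse
        real_sqrt_mult power2_eq_square)
  then have "has_growth_order (sigma_symbol 0 b 0 d) (- 2)"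
    using tendsto_real_sqrt[OF tendsto_mult[OF square_over_quadratic_tendsto[OF b] square_over_quadratic_tendsto[OF d]]] b d
    by (intro has_growth_orderI[of _ _ "sqrt (1 / b * (1 / d))"]) simp_all
  from growth_order_eqI[OF this] False show ?thesis by simp
qed

section \<open>The rate of dissipation at a frequency\<close>

lemma one_plus_mult_sq_pos: "s \<ge> 0 \<Longrightarrow> 0 < 1 + s * (\<xi>::real)\<^sup>2"
  by (simp add: add_pos_nonneg)

lemma omega_same_sign:
  assumes "cond_C1 a b c d \<or> cond_C2 a b c d"
  shows "omega1 a b \<xi> = 0 \<and> omega2 c d \<xi> = 0 \<or> omega1 a b \<xi> * omega2 c d \<xi> > 0"
  using assms
proof
  assume C1: "cond_C1 a b c d"
  then have "0 \<le> - a" "0 \<le> - c" "0 \<le> b" "0 \<le> d" by (auto simp: cond_C1_def)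
  from this[THEN one_plus_mult_sq_pos, of \<xi>] show ?thesis by (simp add: omega1_def omega2_def)
next
  assume C2: "cond_C2 a b c d"
  then have p: "0 < 1 + b * \<xi>\<^sup>2" "0 < 1 + d * \<xi>\<^sup>2" and ac: "c = a"
    by (auto simp: cond_C2_def intro!: one_plus_mult_sq_pos)
  show ?thesis
  proof (cases "1 - a * \<xi>\<^sup>2 = 0")
    case False
    then have "0 < (1 - a * \<xi>\<^sup>2) * (1 - a * \<xi>\<^sup>2)" by (metis not_real_square_gt_zero)
    with p have "0 < (1 - a * \<xi>\<^sup>2) * (1 - a * \<xi>\<^sup>2) / ((1 + b * \<xi>\<^sup>2) * (1 + d * \<xi>\<^sup>2))" by simp
    then show ?thesis by (simp add: omega1_def omega2_def ac)
  qed (simp add: omega1_def omega2_def ac)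
qed

lemma H_symbol_pos_sq:
  assumes "cond_C1 a b c d \<or> cond_C2 a b c d"
  shows "0 < H_symbol a b c d \<xi>" "(H_symbol a b c d \<xi>)\<^sup>2 * omega2 c d \<xi> = omega1 a b \<xi>"
  using omega_same_sign[OF assms, of \<xi>]
  by (auto simp: H_symbol_def zero_less_mult_iff zero_less_divide_iff real_sqrt_pow2 divide_nonpos_neg
      intro: less_imp_le)

text \<open>
  The signed off-diagonal entry of the system at frequency \<open>\<xi>\<close>: by the choice of \<open>H\<close> one has
  \<open>omega2 * H = omega1 / H\<close>, so the same factor \<open>sgn (omega2) * \<xi> * \<sigma>\<close> appears in both equations.
\<close>

definition coupling :: "real \<Rightarrow> real \<Rightarrow> real \<Rightarrow> real \<Rightarrow> real \<Rightarrow> real" where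
  "coupling a b c d \<xi> = \<xi> * omega2 c d \<xi> * H_symbol a b c d \<xi>"

text \<open>
  Written with \<open>\<epsilon>\<close> as a factor, because the strength of the coupling matters through the quotient
  \<open>x\<^sup>2 / \<epsilon>\<close>.
\<close>

lemma coupling_sq:
  assumes "cond_C1 a b c d \<or> cond_C2 a b c d"
  shows "(coupling a b c d \<xi>)\<^sup>2
    = (1 - a * \<xi>\<^sup>2) * (1 - c * \<xi>\<^sup>2) / (1 + b * \<xi>\<^sup>2) * epsilon_symbol d \<xi>"
proof -
  have "(coupling a b c d \<xi>)\<^sup>2 = \<xi>\<^sup>2 * omega2 c d \<xi> * ((H_symbol a b c d \<xi>)\<^sup>2 * omega2 c d \<xi>)"
    by (simp add: coupling_def power_mult_distrib power2_eq_square)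
  also have "\<dots> = \<xi>\<^sup>2 * omega2 c d \<xi> * omega1 a b \<xi>" by (simp only: H_symbol_pos_sq[OF assms])
  finally show ?thesis by (simp add: omega1_def omega2_def epsilon_symbol_def mult_ac)
qed

text \<open>
  Models the decay rate up to a constant: it behaves like \<open>1\<close> away from the degenerate
  frequencies and vanishes quadratically at \<open>0\<close> and at \<open>\<plusminus> q\<close>. If \<open>0\<close> is the only degenerate frequency,
  \<open>q = 0\<close> is used.
\<close>

definition flat_distance :: "real \<Rightarrow> real \<Rightarrow> real" where
  "flat_distance q \<xi> = min 1 (min (\<xi>\<^sup>2) ((\<bar>\<xi>\<bar> - q)\<^sup>2))"

lemma flat_distance_bounds:
  "0 \<le> flat_distance q \<xi>" "flat_distance q \<xi> \<le> 1"
  "flat_distance q \<xi> \<le> \<xi>\<^sup>2" "flat_distance q \<xi> \<le> (\<bar>\<xi>\<bar> - q)\<^sup>2"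
  by (auto simp: flat_distance_def)

lemma flat_distance_le_quotient:
  assumes s: "s \<ge> 0"
  shows "1 / (1 + s) * flat_distance q \<xi> \<le> \<xi>\<^sup>2 / (1 + s * \<xi>\<^sup>2)"
proof -
  define m where "m = flat_distance q \<xi>"
  have m: "m \<le> 1" "m \<le> \<xi>\<^sup>2" "0 \<le> m" unfolding m_def by (simp_all add: flat_distance_bounds)
  have "m * (1 + s * \<xi>\<^sup>2) = m + m * (s * \<xi>\<^sup>2)" by (simp add: algebra_simps)
  also have "\<dots> \<le> \<xi>\<^sup>2 + 1 * (s * \<xi>\<^sup>2)"
    using m s by (intro add_mono mult_right_mono) auto
  also have "\<dots> = (1 + s) * \<xi>\<^sup>2" by (simp add: algebra_simps)
  finally have "m * (1 + s * \<xi>\<^sup>2) \<le> (1 + s) * \<xi>\<^sup>2" .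
  then have "m / (1 + s) \<le> \<xi>\<^sup>2 / (1 + s * \<xi>\<^sup>2)"
    using s one_plus_mult_sq_pos[OF s, of \<xi>] by (simp add: frac_le_eq divide_le_0_iff field_simps)
  then show ?thesis by (simp add: m_def)
qed

text \<open>
  The constant \<open>p / (p + b)\<close> is at most both \<open>1\<close>, the quotient of the two sides (without \<open>k\<close>) at
  \<open>z = 0\<close>, and \<open>p / b\<close>, its limit at infinity.
\<close>

lemma affine_quotient_lower_bound:
  assumes "0 < p" "0 \<le> b"
  shows "\<exists>k>0. \<forall>z\<ge>0. k * (1 + b * z) \<le> 1 + p * (z::real)"
proof (intro exI[of _ "p / (p + b)"] conjI allI impI)
  fix z :: real assume z: "z \<ge> 0"
  have "p * (1 + b * z) \<le> (p + b) * (1 + p * z)"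
    using assms z by (simp add: algebra_simps)
  then show "p / (p + b) * (1 + b * z) \<le> 1 + p * z"
    using assms by (simp add: field_simps)
qed (use assms in auto)

text \<open>
  One of the factors in the numerator grows at least as fast as the denominator, and the other is at least
  \<open>1\<close>. This fails for \<open>a = c = 0 < b\<close>, where the quotient tends to zero.
\<close>

lemma damping_quotient_lower_bound_C1:
  assumes C1: "cond_C1 a b c d" and ne: "b = 0 \<or> a \<noteq> 0 \<or> c \<noteq> 0"
  shows "\<exists>k>0. \<forall>\<xi>. k \<le> (1 - a * \<xi>\<^sup>2) * (1 - c * \<xi>\<^sup>2) / (1 + b * \<xi>\<^sup>2)"
proof -
  have s: "0 \<le> b" "0 \<le> - a" "0 \<le> - c" using C1 by (auto simp: cond_C1_def)
  have ge1: "1 \<le> 1 + p * \<xi>\<^sup>2" if "0 \<le> p" for p \<xi> :: real using that by simp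
  have main: "\<exists>k>0. \<forall>\<xi>. k \<le> (1 + p * \<xi>\<^sup>2) * (1 + p' * \<xi>\<^sup>2) / (1 + b * \<xi>\<^sup>2)"
    if p: "0 \<le> p" "0 \<le> p'" "b = 0 \<or> p > 0" for p p' :: real
  proof -
    have "\<exists>k>0. \<forall>z\<ge>0. k * (1 + b * z) \<le> 1 + p * z"
      using p s(1) affine_quotient_lower_bound[of p b] by (cases "b = 0") (auto intro!: exI[of _ 1])
    then obtain k where k: "k > 0" "\<And>z. z \<ge> 0 \<Longrightarrow> k * (1 + b * z) \<le> 1 + p * z" by blast
    have "k * (1 + b * \<xi>\<^sup>2) \<le> (1 + p * \<xi>\<^sup>2) * (1 + p' * \<xi>\<^sup>2)" for \<xi> :: real
    proof -
      have "k * (1 + b * \<xi>\<^sup>2) \<le> (1 + p * \<xi>\<^sup>2) * 1" using k(2)[of "\<xi>\<^sup>2"] by simp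
      also have "\<dots> \<le> (1 + p * \<xi>\<^sup>2) * (1 + p' * \<xi>\<^sup>2)"
        using p ge1[OF p(2), of \<xi>] ge1[OF p(1), of \<xi>] by (intro mult_left_mono) auto
      finally show ?thesis .
    qed
    then show ?thesis
      using k(1) by (intro exI[of _ k]) (simp add: pos_le_divide_eq one_plus_mult_sq_pos s)
  qed
  show ?thesis
  proof (cases "b = 0 \<or> a \<noteq> 0")
    case True
    then show ?thesis using main[of "- a" "- c"] s by auto
  next
    case False
    then have "b = 0 \<or> - c > 0" using ne s by auto
    then show ?thesis using main[of "- c" "- a"] s by (auto simp: mult.commute)
  qed
qed

text \<open>
  Now the numerator is \<open>(1 - a \<xi>\<^sup>2)\<^sup>2\<close> and vanishes to second order where \<open>\<bar>\<xi>\<bar> = q\<close>, with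
  \<open>q = 1 / sqrt a\<close>. The factor \<open>(q + \<bar>\<xi>\<bar>)\<^sup>2\<close> that remains compensates the denominator.
\<close>

lemma damping_quotient_lower_bound_C2:
  assumes C2: "cond_C2 a b c d"
  shows "\<exists>k>0. \<exists>q. \<forall>\<xi>. k * (\<bar>\<xi>\<bar> - q)\<^sup>2 \<le> (1 - a * \<xi>\<^sup>2) * (1 - c * \<xi>\<^sup>2) / (1 + b * \<xi>\<^sup>2)"
proof -
  have s: "0 \<le> b" "0 < a" and ac: "c = a" using C2 by (auto simp: cond_C2_def)
  define q where "q = 1 / sqrt a"
  have q: "q > 0" "a * q\<^sup>2 = 1" using s by (simp_all add: q_def power_divide)
  obtain k where k: "k > 0" "\<And>z. z \<ge> 0 \<Longrightarrow> k * (1 + b * z) \<le> 1 + a * z"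
    using affine_quotient_lower_bound[OF s(2,1)] by blast
  have "a * k * (\<bar>\<xi>\<bar> - q)\<^sup>2 * (1 + b * \<xi>\<^sup>2) \<le> (1 - a * \<xi>\<^sup>2) * (1 - a * \<xi>\<^sup>2)" for \<xi>
  proof -
    have fac: "1 - a * \<xi>\<^sup>2 = a * ((q - \<bar>\<xi>\<bar>) * (q + \<bar>\<xi>\<bar>))"
    proof -
      have "(q - \<bar>\<xi>\<bar>) * (q + \<bar>\<xi>\<bar>) = q\<^sup>2 - \<xi>\<^sup>2" by (simp add: power2_eq_square algebra_simps)
      then show ?thesis using q(2) by (simp add: right_diff_distrib)
    qed
    have "k * (1 + b * \<xi>\<^sup>2) \<le> 1 + a * \<xi>\<^sup>2" using k(2)[of "\<xi>\<^sup>2"] by simp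
    also have "\<dots> = a * (q\<^sup>2 + \<xi>\<^sup>2)" using q(2) by (simp add: distrib_left)
    also have "\<dots> \<le> a * (q + \<bar>\<xi>\<bar>)\<^sup>2" using s q(1) by (simp add: power2_sum)
    finally have "(a * (\<bar>\<xi>\<bar> - q)\<^sup>2) * (k * (1 + b * \<xi>\<^sup>2)) \<le> (a * (\<bar>\<xi>\<bar> - q)\<^sup>2) * (a * (q + \<bar>\<xi>\<bar>)\<^sup>2)"
      using s by (intro mult_left_mono) auto
    also have "\<dots> = (1 - a * \<xi>\<^sup>2) * (1 - a * \<xi>\<^sup>2)"
      unfolding fac by (simp add: power2_eq_square algebra_simps)
    finally show ?thesis by (simp add: mult_ac)
  qed
  then have "\<forall>\<xi>. a * k * (\<bar>\<xi>\<bar> - q)\<^sup>2 \<le> (1 - a * \<xi>\<^sup>2) * (1 - c * \<xi>\<^sup>2) / (1 + b * \<xi>\<^sup>2)"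
    by (simp add: pos_le_divide_eq one_plus_mult_sq_pos s ac)
  moreover have "a * k > 0" using s k by simp
  ultimately show ?thesis by blast
qed

text \<open>
  The rate \<open>k * flat_distance q\<close> satisfies the hypotheses of \<open>damped_system_decay\<close> at every frequency.
  This is where the condition on the orders enters: it rules out \<open>a = c = 0 < b\<close>, since then
  \<open>order \<sigma> = -2 + 1/2 order \<epsilon>\<close>.
\<close>

lemma dissipation_rate_lower_bound:
  assumes C12: "cond_C1 a b c d \<or> cond_C2 a b c d"
    and nu: "\<nu> = 1 \<or> \<nu> = 0 \<and> growth_order (sigma_symbol a b c d) > - 2 + 1 / 2 * growth_order (epsilon_symbol d)"
  shows "\<exists>k>0. \<exists>q. \<forall>\<xi>. k * flat_distance q \<xi> \<le> epsilon_symbol d \<xi> \<and>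
    (k * flat_distance q \<xi> \<le> \<nu> * (\<xi>\<^sup>2 / (1 + b * \<xi>\<^sup>2)) \<or>
     \<nu> * (\<xi>\<^sup>2 / (1 + b * \<xi>\<^sup>2)) = 0 \<and> k * flat_distance q \<xi> * epsilon_symbol d \<xi> \<le> (coupling a b c d \<xi>)\<^sup>2)"
  using nu
proof
  assume \<nu>: "\<nu> = 1"
  have bd: "0 \<le> b" "0 \<le> d" using C12 by (auto simp: cond_C1_def cond_C2_def)
  define k where "k = min (1 / (1 + b)) (1 / (1 + d))"
  have "k * flat_distance 0 \<xi> \<le> epsilon_symbol d \<xi>" "k * flat_distance 0 \<xi> \<le> \<xi>\<^sup>2 / (1 + b * \<xi>\<^sup>2)" for \<xi>
  proof -
    have "k * flat_distance 0 \<xi> \<le> 1 / (1 + d) * flat_distance 0 \<xi>" "k * flat_distance 0 \<xi> \<le> 1 / (1 + b) * flat_distance 0 \<xi>"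
      unfolding k_def by (intro mult_right_mono flat_distance_bounds; simp)+
    then show "k * flat_distance 0 \<xi> \<le> epsilon_symbol d \<xi>" "k * flat_distance 0 \<xi> \<le> \<xi>\<^sup>2 / (1 + b * \<xi>\<^sup>2)"
      unfolding epsilon_symbol_def using flat_distance_le_quotient[OF bd(1), of 0 \<xi>] flat_distance_le_quotient[OF bd(2), of 0 \<xi>]
      by linarith+
  qed
  moreover have "k > 0" using bd by (simp add: k_def)
  ultimately show ?thesis using \<nu> by (intro exI[of _ k] conjI exI[of _ 0]) auto
next
  assume \<nu>: "\<nu> = 0 \<and> growth_order (sigma_symbol a b c d) > - 2 + 1 / 2 * growth_order (epsilon_symbol d)"
  have bd: "0 \<le> b" "0 \<le> d" using C12 by (auto simp: cond_C1_def cond_C2_def)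
  have "\<exists>k>0. \<exists>q. \<forall>\<xi>. k * flat_distance q \<xi> \<le> (1 - a * \<xi>\<^sup>2) * (1 - c * \<xi>\<^sup>2) / (1 + b * \<xi>\<^sup>2)"
    using C12
  proof
    assume C1: "cond_C1 a b c d"
    have "b = 0 \<or> a \<noteq> 0 \<or> c \<noteq> 0"
    proof (rule ccontr)
      assume "\<not> ?thesis"
      then have "a = 0" "c = 0" "b > 0" using bd by auto
      with \<nu> growth_order_epsilon[OF bd(2)] growth_order_sigma[OF _ bd(2), of b] show False
        by (auto split: if_splits)
    qed
    from damping_quotient_lower_bound_C1[OF C1 this] obtain k
      where k: "k > 0" "\<And>\<xi>. k \<le> (1 - a * \<xi>\<^sup>2) * (1 - c * \<xi>\<^sup>2) / (1 + b * \<xi>\<^sup>2)" by blast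
    have "k * flat_distance 0 \<xi> \<le> k" for \<xi>
      using k(1) flat_distance_bounds(2)[of 0 \<xi>] by (simp add: mult_left_le)
    then have "k * flat_distance 0 \<xi> \<le> (1 - a * \<xi>\<^sup>2) * (1 - c * \<xi>\<^sup>2) / (1 + b * \<xi>\<^sup>2)" for \<xi>
      using k(2) order_trans by blast
    with k(1) show ?thesis by blast
  next
    assume "cond_C2 a b c d"
    from damping_quotient_lower_bound_C2[OF this] obtain k q
      where k: "k > 0" "\<And>\<xi>. k * (\<bar>\<xi>\<bar> - q)\<^sup>2 \<le> (1 - a * \<xi>\<^sup>2) * (1 - c * \<xi>\<^sup>2) / (1 + b * \<xi>\<^sup>2)" by blast
    have "k * flat_distance q \<xi> \<le> k * (\<bar>\<xi>\<bar> - q)\<^sup>2" for \<xi>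
      using k(1) flat_distance_bounds(4)[of q \<xi>] by (simp add: mult_left_mono)
    then have "k * flat_distance q \<xi> \<le> (1 - a * \<xi>\<^sup>2) * (1 - c * \<xi>\<^sup>2) / (1 + b * \<xi>\<^sup>2)" for \<xi>
      using k(2) order_trans by blast
    with k(1) show ?thesis by blast
  qed
  then obtain k q where k: "k > 0"
    and kq: "\<And>\<xi>. k * flat_distance q \<xi> \<le> (1 - a * \<xi>\<^sup>2) * (1 - c * \<xi>\<^sup>2) / (1 + b * \<xi>\<^sup>2)" by blast
  define K where "K = min k (1 / (1 + d))"
  have "K * flat_distance q \<xi> \<le> epsilon_symbol d \<xi> \<and> K * flat_distance q \<xi> * epsilon_symbol d \<xi> \<le> (coupling a b c d \<xi>)\<^sup>2" for \<xi>
  proof -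
    have "K * flat_distance q \<xi> \<le> 1 / (1 + d) * flat_distance q \<xi>" "K * flat_distance q \<xi> \<le> k * flat_distance q \<xi>"
      unfolding K_def by (intro mult_right_mono flat_distance_bounds; simp)+
    then have 1: "K * flat_distance q \<xi> \<le> epsilon_symbol d \<xi>"
      and 2: "K * flat_distance q \<xi> \<le> (1 - a * \<xi>\<^sup>2) * (1 - c * \<xi>\<^sup>2) / (1 + b * \<xi>\<^sup>2)"
      unfolding epsilon_symbol_def using flat_distance_le_quotient[OF bd(2), of q \<xi>] kq[of \<xi>] by linarith+
    have "0 \<le> epsilon_symbol d \<xi>" using bd by (simp add: epsilon_symbol_def)
    with 1 2 show ?thesis unfolding coupling_sq[OF C12] by (intro conjI mult_right_mono)
  qed
  moreover have "K > 0" using k bd by (simp add: K_def)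
  ultimately show ?thesis using \<nu> by (intro exI[of _ K] conjI exI[of _ q]) auto
qed

text \<open>
  Multiplying the first equation by \<open>1 + b \<xi>\<^sup>2\<close>, and the second by \<open>1 + d \<xi>\<^sup>2\<close>, clears the
  denominators of the symbols. The equivalence is used from left to right to estimate an arbitrary
  solution, and from right to left to construct one.
\<close>

lemma frequency_system_iff:
  fixes \<eta>' u' \<eta> u :: complex and \<xi> \<nu> :: real
  assumes C12: "cond_C1 a b c d \<or> cond_C2 a b c d"
  defines "H \<equiv> complex_of_real (H_symbol a b c d \<xi>)" and "x \<equiv> coupling a b c d \<xi>"
  shows "(let D = \<i> * of_real \<xi> in
           \<eta>' + D * u + of_real a * D ^ 3 * u - of_real b * D\<^sup>2 * \<eta>' = of_real \<nu> * D\<^sup>2 * \<eta> \<and>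
           u' + D * \<eta> + of_real c * D ^ 3 * \<eta> - of_real d * D\<^sup>2 * u' = D\<^sup>2 * u)
    \<longleftrightarrow> \<eta>' = - (\<i> * of_real x) * (H * u) - of_real (\<nu> * (\<xi>\<^sup>2 / (1 + b * \<xi>\<^sup>2))) * \<eta> \<and>
        H * u' = - (\<i> * of_real x) * \<eta> - of_real (epsilon_symbol d \<xi>) * (H * u)"
proof -
  have bd: "0 \<le> b" "0 \<le> d" using C12 by (auto simp: cond_C1_def cond_C2_def)
  note pos = one_plus_mult_sq_pos[OF bd(1), of \<xi>] one_plus_mult_sq_pos[OF bd(2), of \<xi>]
  define h where "h = H_symbol a b c d \<xi>"
  have h: "h > 0" "h\<^sup>2 * omega2 c d \<xi> = omega1 a b \<xi>"
    using H_symbol_pos_sq[OF C12] by (auto simp: h_def)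
  define A where "A = \<nu> * (\<xi>\<^sup>2 / (1 + b * \<xi>\<^sup>2))"
  define e where "e = epsilon_symbol d \<xi>"
  define B where "B = 1 + b * \<xi>\<^sup>2"
  define E where "E = 1 + d * \<xi>\<^sup>2"
  have BE: "B > 0" "E > 0" using pos by (auto simp: B_def E_def)
  have "x * h = \<xi> * (h\<^sup>2 * omega2 c d \<xi>)"
    by (simp add: x_def coupling_def h_def power2_eq_square)
  then have e1: "B * (x * h) = \<xi> * (1 - a * \<xi>\<^sup>2)"
    unfolding h using BE by (simp add: omega1_def B_def)
  have e2: "B * A = \<nu> * \<xi>\<^sup>2" using BE by (simp add: A_def B_def)
  have e3: "E * x = h * (\<xi> * (1 - c * \<xi>\<^sup>2))"
    using BE by (simp add: x_def coupling_def h_def omega2_def E_def)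
  have e4: "E * e = \<xi>\<^sup>2" using BE by (simp add: e_def epsilon_symbol_def E_def)
  have D: "(\<i> * complex_of_real \<xi>)\<^sup>2 = - of_real (\<xi>\<^sup>2)" "(\<i> * of_real \<xi>) ^ 3 = - (\<i> * of_real (\<xi> * \<xi>\<^sup>2))"
    by (simp_all add: power_mult_distrib) (simp_all add: power2_eq_square power3_eq_cube)
  have 1: "(\<eta>' + \<i> * of_real \<xi> * u + of_real a * (\<i> * of_real \<xi>) ^ 3 * u - of_real b * (\<i> * of_real \<xi>)\<^sup>2 * \<eta>'
       = of_real \<nu> * (\<i> * of_real \<xi>)\<^sup>2 * \<eta>) \<longleftrightarrow> \<eta>' = - (\<i> * of_real x) * (H * u) - of_real A * \<eta>"
  proof -
    have "(\<eta>' + \<i> * of_real \<xi> * u + of_real a * (\<i> * of_real \<xi>) ^ 3 * u - of_real b * (\<i> * of_real \<xi>)\<^sup>2 * \<eta>')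
         - of_real \<nu> * (\<i> * of_real \<xi>)\<^sup>2 * \<eta>
       = of_real B * \<eta>' + \<i> * of_real (\<xi> * (1 - a * \<xi>\<^sup>2)) * u + of_real (\<nu> * \<xi>\<^sup>2) * \<eta>"
      unfolding D by (simp add: B_def algebra_simps)
    also have "\<dots> = of_real B * (\<eta>' - (- (\<i> * of_real x) * (H * u) - of_real A * \<eta>))"
      unfolding e1[symmetric] e2[symmetric] by (simp add: H_def h_def algebra_simps)
    finally show ?thesis using BE by (metis eq_iff_diff_eq_0 mult_eq_0_iff of_real_eq_0_iff less_irrefl)
  qed
  have 2: "(u' + \<i> * of_real \<xi> * \<eta> + of_real c * (\<i> * of_real \<xi>) ^ 3 * \<eta> - of_real d * (\<i> * of_real \<xi>)\<^sup>2 * u'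
       = (\<i> * of_real \<xi>)\<^sup>2 * u) \<longleftrightarrow> H * u' = - (\<i> * of_real x) * \<eta> - of_real e * (H * u)"
  proof -
    have "of_real h * ((u' + \<i> * of_real \<xi> * \<eta> + of_real c * (\<i> * of_real \<xi>) ^ 3 * \<eta> - of_real d * (\<i> * of_real \<xi>)\<^sup>2 * u')
         - (\<i> * of_real \<xi>)\<^sup>2 * u)
       = of_real E * (of_real h * u') + \<i> * of_real (h * (\<xi> * (1 - c * \<xi>\<^sup>2))) * \<eta> + of_real h * of_real (\<xi>\<^sup>2) * u"
      unfolding D by (simp add: E_def algebra_simps)
    also have "\<dots> = of_real E * (H * u' - (- (\<i> * of_real x) * \<eta> - of_real e * (H * u)))"
      unfolding e3[symmetric] unfolding e4[symmetric] by (simp add: H_def h_def algebra_simps)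
    finally show ?thesis using BE h(1) by (metis eq_iff_diff_eq_0 mult_eq_0_iff of_real_eq_0_iff less_irrefl)
  qed
  show ?thesis unfolding Let_def 1 2 A_def e_def ..
qed

section \<open>Integrating the frequencywise decay\<close>

lemma gaussian_integral:
  assumes s: "s > 0"
  shows "integrable lborel (\<lambda>\<xi>. exp (- s * (\<xi> - p)\<^sup>2) :: real)"
    and "(LINT \<xi>|lborel. exp (- s * (\<xi> - p)\<^sup>2)) = sqrt (pi / s)"
proof -
  have *: "exp (- s * (\<xi> - p)\<^sup>2) = sqrt (pi / s) * normal_density p (sqrt (1 / (2 * s))) \<xi>" for \<xi>
    using s by (simp add: normal_density_def real_sqrt_divide real_sqrt_mult field_simps)
  have "sqrt (1 / (2 * s)) > 0" using s by simp
  then show "integrable lborel (\<lambda>\<xi>. exp (- s * (\<xi> - p)\<^sup>2) :: real)"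
    "(LINT \<xi>|lborel. exp (- s * (\<xi> - p)\<^sup>2)) = sqrt (pi / s)"
    unfolding * by simp_all
qed

text \<open>
  The minimum is attained by one of four expressions. A sum of exponentials, rather than a partition
  of the frequencies, then leaves only Gaussian integrals over the whole line.
\<close>

lemma exp_flat_distance_le:
  assumes "s \<ge> 0"
  shows "exp (- s * flat_distance q \<xi>)
    \<le> exp (- s) + exp (- s * (\<xi> - 0)\<^sup>2) + exp (- s * (\<xi> - q)\<^sup>2) + exp (- s * (\<xi> - (- q))\<^sup>2)"
proof -
  have "flat_distance q \<xi> \<in> {1, \<xi>\<^sup>2, (\<xi> - q)\<^sup>2, (\<xi> - (- q))\<^sup>2}"
    by (auto simp: flat_distance_def min_def abs_if power2_eq_square algebra_simps)
  then show ?thesis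
    using exp_gt_zero[of "- s"] exp_gt_zero[of "- s * \<xi>\<^sup>2"] exp_gt_zero[of "- s * (\<xi> - q)\<^sup>2"]
      exp_gt_zero[of "- s * (\<xi> - (- q))\<^sup>2"] by (auto simp del: exp_gt_zero)
qed

text \<open>
  The constant term of the sum is paired with the integral of \<open>g\<close>, the three Gaussians with its
  upper bound \<open>M\<close>.
\<close>

lemma flat_distance_decay:
  fixes g :: "real \<Rightarrow> real"
  assumes g: "integrable lborel g" and M: "\<And>\<xi>. 0 \<le> g \<xi>" "\<And>\<xi>. g \<xi> \<le> M" and s: "s > 0"
  shows "integrable lborel (\<lambda>\<xi>. exp (- s * flat_distance q \<xi>) * g \<xi>)"
    and "(LINT \<xi>|lborel. exp (- s * flat_distance q \<xi>) * g \<xi>)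
      \<le> ((LINT \<xi>|lborel. g \<xi>) + 3 * M * sqrt pi) / sqrt s"
proof -
  have [measurable]: "g \<in> borel_measurable lborel" "flat_distance q \<in> borel_measurable lborel"
    using g by (auto simp: flat_distance_def[abs_def])
  show i: "integrable lborel (\<lambda>\<xi>. exp (- s * flat_distance q \<xi>) * g \<xi>)"
  proof (rule Bochner_Integration.integrable_bound[OF g])
    have "exp (- s * flat_distance q \<xi>) * g \<xi> \<le> 1 * g \<xi>" for \<xi>
      using s M(1) by (intro mult_right_mono) (auto simp: flat_distance_bounds)
    then show "AE \<xi> in lborel. norm (exp (- s * flat_distance q \<xi>) * g \<xi>) \<le> norm (g \<xi>)"
      using M(1) by (simp add: abs_mult)
  qed measurable
  have "(LINT \<xi>|lborel. exp (- s * flat_distance q \<xi>) * g \<xi>)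
    \<le> (LINT \<xi>|lborel. exp (- s) * g \<xi> + (M * exp (- s * (\<xi> - 0)\<^sup>2) + (M * exp (- s * (\<xi> - q)\<^sup>2)
        + M * exp (- s * (\<xi> - (- q))\<^sup>2))))"
  proof (rule integral_mono[OF i])
    show "integrable lborel (\<lambda>\<xi>. exp (- s) * g \<xi> + (M * exp (- s * (\<xi> - 0)\<^sup>2) + (M * exp (- s * (\<xi> - q)\<^sup>2)
        + M * exp (- s * (\<xi> - (- q))\<^sup>2))))"
      by (intro Bochner_Integration.integrable_add integrable_mult_right g gaussian_integral s)
    fix \<xi>
    have "exp (- s * flat_distance q \<xi>) * g \<xi>
       \<le> (exp (- s) + exp (- s * (\<xi> - 0)\<^sup>2) + exp (- s * (\<xi> - q)\<^sup>2) + exp (- s * (\<xi> - (- q))\<^sup>2)) * g \<xi>"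
      using exp_flat_distance_le[of s q \<xi>] s M(1) by (intro mult_right_mono) auto
    also have "\<dots> = exp (- s) * g \<xi> + (g \<xi> * exp (- s * (\<xi> - 0)\<^sup>2) + (g \<xi> * exp (- s * (\<xi> - q)\<^sup>2)
        + g \<xi> * exp (- s * (\<xi> - (- q))\<^sup>2)))"
    proof -
      have "(w + x + y + z) * v = w * v + (v * x + (v * y + v * z))" for v w x y z :: real
        by (simp add: algebra_simps)
      then show ?thesis .
    qed
    also have "\<dots> \<le> exp (- s) * g \<xi> + (M * exp (- s * (\<xi> - 0)\<^sup>2) + (M * exp (- s * (\<xi> - q)\<^sup>2)
        + M * exp (- s * (\<xi> - (- q))\<^sup>2)))"
      using M by (intro add_mono mult_right_mono) auto
    finally show "exp (- s * flat_distance q \<xi>) * g \<xi> \<le> exp (- s) * g \<xi> + (M * exp (- s * (\<xi> - 0)\<^sup>2)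
        + (M * exp (- s * (\<xi> - q)\<^sup>2) + M * exp (- s * (\<xi> - (- q))\<^sup>2)))" .
  qed
  also have "\<dots> = exp (- s) * (LINT \<xi>|lborel. g \<xi>) + 3 * M * sqrt (pi / s)"
  proof -
    note gi = gaussian_integral[OF s]
    have j: "integrable lborel (\<lambda>\<xi>. M * exp (- s * (\<xi> - p)\<^sup>2))" for p
      by (intro integrable_mult_right gi)
    have v: "(LINT \<xi>|lborel. M * exp (- s * (\<xi> - p)\<^sup>2)) = M * sqrt (pi / s)" for p
      using gi(2)[of p] by simp
    have j3: "integrable lborel (\<lambda>\<xi>. M * exp (- s * (\<xi> - q)\<^sup>2) + M * exp (- s * (\<xi> - (- q))\<^sup>2))"
      by (intro Bochner_Integration.integrable_add j)
    have j4: "integrable lborel (\<lambda>\<xi>. M * exp (- s * (\<xi> - 0)\<^sup>2) + (M * exp (- s * (\<xi> - q)\<^sup>2) + M * exp (- s * (\<xi> - (- q))\<^sup>2)))"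
      by (intro Bochner_Integration.integrable_add j)
    show ?thesis
      unfolding Bochner_Integration.integral_add[OF integrable_mult_right[OF g] j4] Bochner_Integration.integral_add[OF j j3]
        Bochner_Integration.integral_add[OF j j] v by simp
  qed
  also have "\<dots> \<le> 1 / sqrt s * (LINT \<xi>|lborel. g \<xi>) + 3 * M * sqrt (pi / s)"
  proof -
    (* This puts the exponentially decaying part under the same power of s as the Gaussians. *)
    have "sqrt s \<le> exp s"
    proof (rule real_le_lsqrt)
      have "s \<le> 1 + 2 * s" "1 + 2 * s \<le> exp (2 * s)" using s exp_ge_add_one_self[of "2 * s"] by auto
      then show "s \<le> (exp s)\<^sup>2" by (simp add: exp_double)
    qed (use s in auto)
    then have "exp (- s) \<le> 1 / sqrt s" using s by (simp add: exp_minus field_simps)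
    moreover have "0 \<le> (LINT \<xi>|lborel. g \<xi>)" using M(1) by (simp add: integral_nonneg_AE)
    ultimately show ?thesis by (intro add_right_mono mult_right_mono)
  qed
  also have "\<dots> = ((LINT \<xi>|lborel. g \<xi>) + 3 * M * sqrt pi) / sqrt s"
    by (simp add: real_sqrt_divide add_divide_distrib)
  finally show "(LINT \<xi>|lborel. exp (- s * flat_distance q \<xi>) * g \<xi>)
      \<le> ((LINT \<xi>|lborel. g \<xi>) + 3 * M * sqrt pi) / sqrt s" .
qed

section \<open>Existence and decay of solutions\<close>

lemma borel_measurable_symbols [measurable]:
  "H_symbol a b c d \<in> borel_measurable borel"
  "coupling a b c d \<in> borel_measurable borel"
  "epsilon_symbol d \<in> borel_measurable borel"
proof -
  have [measurable]: "omega1 a b \<in> borel_measurable borel" "omega2 c d \<in> borel_measurable borel"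
    by (simp_all add: omega1_def[abs_def] omega2_def[abs_def])
  show H[measurable]: "H_symbol a b c d \<in> borel_measurable borel"
    unfolding H_symbol_def[abs_def] by measurable
  show "coupling a b c d \<in> borel_measurable borel"
    unfolding coupling_def[abs_def] by measurable
  show "epsilon_symbol d \<in> borel_measurable borel"
    by (simp add: epsilon_symbol_def[abs_def])
qed

lemma square_integrable_of_sq_le:
  assumes f: "square_integrable f" and g: "square_integrable g"
    and h: "h \<in> borel_measurable borel" "\<And>x. (cmod (h x))\<^sup>2 \<le> C * ((cmod (f x))\<^sup>2 + (cmod (g x))\<^sup>2)"
  shows "square_integrable h"
proof -
  have [measurable]: "h \<in> borel_measurable lborel" using h by simp
  have "integrable lborel (\<lambda>x. C * ((cmod (f x))\<^sup>2 + (cmod (g x))\<^sup>2))"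
    using f g by (simp add: square_integrable_def)
  then have "integrable lborel (\<lambda>x. (cmod (h x))\<^sup>2)"
  proof (rule Bochner_Integration.integrable_bound)
    have "norm ((cmod (h x))\<^sup>2) \<le> norm (C * ((cmod (f x))\<^sup>2 + (cmod (g x))\<^sup>2))" for x
      using h(2)[of x] by simp
    then show "AE x in lborel. norm ((cmod (h x))\<^sup>2) \<le> norm (C * ((cmod (f x))\<^sup>2 + (cmod (g x))\<^sup>2))"
      by simp
  qed measurable
  then show ?thesis by (simp add: square_integrable_def)
qed

text \<open>
  At each frequency the system is solved explicitly. The energy does not increase, so the
  solution stays square integrable in \<open>\<xi>\<close> and is the transform of functions of \<open>x\<close>.
\<close>

lemma linear_solution_exists:
  assumes C12: "cond_C1 a b c d \<or> cond_C2 a b c d" and nu: "0 \<le> \<nu>"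
    and eta0: "integrable lborel \<eta>0" "square_integrable \<eta>0"
    and w0: "integrable lborel w0" "square_integrable w0"
    and Hu0: "AE \<xi> in lborel. fourier w0 \<xi> = of_real (H_symbol a b c d \<xi>) * uh0 \<xi>"
  shows "\<exists>\<eta> w uh. linear_solution \<nu> a b c d \<eta>0 uh0 \<eta> w uh"
proof -
  have bd: "0 \<le> b" "0 \<le> d" using C12 by (auto simp: cond_C1_def cond_C2_def)
  note [measurable] = borel_measurable_integrable[OF eta0(1)] borel_measurable_integrable[OF w0(1)]
  define A where "A \<xi> = \<nu> * (\<xi>\<^sup>2 / (1 + b * \<xi>\<^sup>2))" for \<xi>
  have A0: "0 \<le> A \<xi>" and e0: "0 \<le> epsilon_symbol d \<xi>" for \<xi>
    using nu bd by (simp_all add: A_def epsilon_symbol_def)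
  have [measurable]: "A \<in> borel_measurable borel" by (simp add: A_def[abs_def])
  let ?H = "\<lambda>\<xi>. complex_of_real (H_symbol a b c d \<xi>)"
  have H: "H_symbol a b c d \<xi> \<noteq> 0" for \<xi> using H_symbol_pos_sq(1)[OF C12, of \<xi>] by simp
  define yh where "yh t \<xi> = damped_component (coupling a b c d \<xi>) (A \<xi>) (epsilon_symbol d \<xi>) (fourier \<eta>0 \<xi>) (fourier w0 \<xi>) t" for t \<xi>
  define wh where "wh t \<xi> = damped_component (coupling a b c d \<xi>) (epsilon_symbol d \<xi>) (A \<xi>) (fourier w0 \<xi>) (fourier \<eta>0 \<xi>) t" for t \<xi>
  define uh where "uh t \<xi> = wh t \<xi> / ?H \<xi>" for t \<xi>
  have Huh: "?H \<xi> * uh t \<xi> = wh t \<xi>" for t \<xi> using H by (simp add: uh_def)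
  have dy: "((\<lambda>s. yh s \<xi>) has_vector_derivative
      - (\<i> * of_real (coupling a b c d \<xi>)) * wh t \<xi> - of_real (A \<xi>) * yh t \<xi>) (at t within S)"
    and dw: "((\<lambda>s. wh s \<xi>) has_vector_derivative
      - (\<i> * of_real (coupling a b c d \<xi>)) * yh t \<xi> - of_real (epsilon_symbol d \<xi>) * wh t \<xi>) (at t within S)" for t \<xi> S
    unfolding yh_def wh_def by (rule damped_component_derivative)+
  have sq0: "square_integrable (fourier \<eta>0)" "square_integrable (fourier w0)"
    by (intro Plancherel eta0 w0)+
  have bound: "(cmod (yh t \<xi>))\<^sup>2 + (cmod (wh t \<xi>))\<^sup>2 \<le> 2 * ((cmod (fourier \<eta>0 \<xi>))\<^sup>2 + (cmod (fourier w0 \<xi>))\<^sup>2)"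
    if "t \<ge> 0" for t \<xi>
    (* the rate zero is admissible, and gives the mere boundedness of the energy *)
    using damped_system_decay[of "\<lambda>s. yh s \<xi>" "coupling a b c d \<xi>" "\<lambda>s. wh s \<xi>" "A \<xi>" "epsilon_symbol d \<xi>" 0 t]
      dy dw A0[of \<xi>] e0[of \<xi>] that by (simp add: yh_def wh_def)
  have ysq: "square_integrable (yh t)" and wsq: "square_integrable (wh t)" if t: "t \<ge> 0" for t
  proof -
    have "(cmod (yh t \<xi>))\<^sup>2 \<le> 2 * ((cmod (fourier \<eta>0 \<xi>))\<^sup>2 + (cmod (fourier w0 \<xi>))\<^sup>2)"
      "(cmod (wh t \<xi>))\<^sup>2 \<le> 2 * ((cmod (fourier \<eta>0 \<xi>))\<^sup>2 + (cmod (fourier w0 \<xi>))\<^sup>2)" for \<xi>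
      using bound[OF t, of \<xi>] by (smt (verit) zero_le_power2)+
    moreover have "yh t \<in> borel_measurable borel" "wh t \<in> borel_measurable borel"
      unfolding yh_def[abs_def] wh_def[abs_def] by measurable
    ultimately show "square_integrable (yh t)" "square_integrable (wh t)"
      using square_integrable_of_sq_le[OF sq0] by blast+
  qed
  have "\<exists>\<eta>. \<forall>t. t \<ge> 0 \<longrightarrow> has_fourier_L2 (\<eta> t) (yh t)"
    by (intro choice allI) (use has_fourier_L2_surj[OF ysq] in auto)
  then obtain \<eta> where \<eta>: "\<And>t. t \<ge> 0 \<Longrightarrow> has_fourier_L2 (\<eta> t) (yh t)" by blast
  have "\<exists>w. \<forall>t. t \<ge> 0 \<longrightarrow> has_fourier_L2 (w t) (wh t)"
    by (intro choice allI) (use has_fourier_L2_surj[OF wsq] in auto)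
  then obtain w where w: "\<And>t. t \<ge> 0 \<Longrightarrow> has_fourier_L2 (w t) (wh t)" by blast
  have ode: "\<exists>\<eta>' uh'. ((\<lambda>s. yh s \<xi>) has_vector_derivative \<eta>') (at t within {0..}) \<and>
      ((\<lambda>s. uh s \<xi>) has_vector_derivative uh') (at t within {0..}) \<and>
      (let D = \<i> * of_real \<xi> in
         \<eta>' + D * uh t \<xi> + of_real a * D ^ 3 * uh t \<xi> - of_real b * D\<^sup>2 * \<eta>' = of_real \<nu> * D\<^sup>2 * yh t \<xi> \<and>
         uh' + D * yh t \<xi> + of_real c * D ^ 3 * yh t \<xi> - of_real d * D\<^sup>2 * uh' = D\<^sup>2 * uh t \<xi>)" for t \<xi>
  proof (intro exI conjI)
    show "((\<lambda>s. uh s \<xi>) has_vector_derivative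
       (- (\<i> * of_real (coupling a b c d \<xi>)) * yh t \<xi> - of_real (epsilon_symbol d \<xi>) * wh t \<xi>) / ?H \<xi>) (at t within {0..})"
      unfolding uh_def by (rule has_vector_derivative_divide[OF dw])
  qed (rule dy, subst frequency_system_iff[OF C12], simp add: Huh H A_def)
  have "linear_solution \<nu> a b c d \<eta>0 uh0 \<eta> w uh"
    unfolding linear_solution_def H_maps_def Huh
  proof (intro exI[of _ yh] conjI allI impI)
    show "AE \<xi> in lborel. yh 0 \<xi> = fourier \<eta>0 \<xi> \<and> uh 0 \<xi> = uh0 \<xi> \<and>
           (\<forall>t\<ge>0. \<exists>\<eta>h' uh'.
              ((\<lambda>s. yh s \<xi>) has_vector_derivative \<eta>h') (at t within {0..}) \<and>
              ((\<lambda>s. uh s \<xi>) has_vector_derivative uh') (at t within {0..}) \<and>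
              (let D = \<i> * of_real \<xi> in
                 \<eta>h' + D * uh t \<xi> + of_real a * D ^ 3 * uh t \<xi> - of_real b * D\<^sup>2 * \<eta>h'
                   = of_real \<nu> * D\<^sup>2 * yh t \<xi> \<and>
                 uh' + D * yh t \<xi> + of_real c * D ^ 3 * yh t \<xi> - of_real d * D\<^sup>2 * uh'
                   = D\<^sup>2 * uh t \<xi>))"
      using Hu0
    proof eventually_elim
      case (elim \<xi>)
      then have "uh 0 \<xi> = uh0 \<xi>" using H by (simp add: uh_def wh_def)
      then show ?case using ode[of \<xi>] by (simp add: yh_def[of 0])
    qed
  qed (use \<eta> w in auto)
  then show ?thesis by blast
qed

text \<open>
  At almost every frequency, the transforms of an arbitrary solution satisfy the damped system, so
  the energy estimate holds for every solution, not only for the constructed one.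
\<close>

lemma linear_solution_pointwise_decay:
  assumes C12: "cond_C1 a b c d \<or> cond_C2 a b c d"
    and r: "\<And>\<xi>. 0 \<le> r \<xi>" "\<And>\<xi>. r \<xi> \<le> epsilon_symbol d \<xi>"
      "\<And>\<xi>. r \<xi> \<le> \<nu> * (\<xi>\<^sup>2 / (1 + b * \<xi>\<^sup>2)) \<or>
        \<nu> * (\<xi>\<^sup>2 / (1 + b * \<xi>\<^sup>2)) = 0 \<and> r \<xi> * epsilon_symbol d \<xi> \<le> (coupling a b c d \<xi>)\<^sup>2"
    and Hu0: "AE \<xi> in lborel. fourier w0 \<xi> = of_real (H_symbol a b c d \<xi>) * uh0 \<xi>"
    and sol: "linear_solution \<nu> a b c d \<eta>0 uh0 \<eta> w uh" and t: "t \<ge> 0"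
  shows "\<exists>f g. has_fourier_L2 (\<eta> t) f \<and> has_fourier_L2 (w t) g \<and>
    (AE \<xi> in lborel. (cmod (f \<xi>))\<^sup>2 + (cmod (g \<xi>))\<^sup>2
       \<le> 2 * exp (- (r \<xi> / 4) * t) * ((cmod (fourier \<eta>0 \<xi>))\<^sup>2 + (cmod (fourier w0 \<xi>))\<^sup>2))"
proof -
  let ?H = "\<lambda>\<xi>. complex_of_real (H_symbol a b c d \<xi>)"
  obtain \<eta>h where L2: "has_fourier_L2 (\<eta> t) (\<eta>h t)" "has_fourier_L2 (w t) (\<lambda>\<xi>. ?H \<xi> * uh t \<xi>)"
    and ode: "AE \<xi> in lborel.
           \<eta>h 0 \<xi> = fourier \<eta>0 \<xi> \<and> uh 0 \<xi> = uh0 \<xi> \<and>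
           (\<forall>t\<ge>0. \<exists>\<eta>h' uh'.
              ((\<lambda>s. \<eta>h s \<xi>) has_vector_derivative \<eta>h') (at t within {0..}) \<and>
              ((\<lambda>s. uh s \<xi>) has_vector_derivative uh') (at t within {0..}) \<and>
              (let D = \<i> * of_real \<xi> in
                 \<eta>h' + D * uh t \<xi> + of_real a * D ^ 3 * uh t \<xi> - of_real b * D\<^sup>2 * \<eta>h'
                   = of_real \<nu> * D\<^sup>2 * \<eta>h t \<xi> \<and>
                 uh' + D * \<eta>h t \<xi> + of_real c * D ^ 3 * \<eta>h t \<xi> - of_real d * D\<^sup>2 * uh'
                   = D\<^sup>2 * uh t \<xi>))"
    using sol t unfolding linear_solution_def H_maps_def by blast
  have "AE \<xi> in lborel. (cmod (\<eta>h t \<xi>))\<^sup>2 + (cmod (?H \<xi> * uh t \<xi>))\<^sup>2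
       \<le> 2 * exp (- (r \<xi> / 4) * t) * ((cmod (fourier \<eta>0 \<xi>))\<^sup>2 + (cmod (fourier w0 \<xi>))\<^sup>2)"
    using ode Hu0
  proof eventually_elim
    case (elim \<xi>)
    have d: "((\<lambda>s. \<eta>h s \<xi>) has_vector_derivative
        - (\<i> * of_real (coupling a b c d \<xi>)) * (?H \<xi> * uh s \<xi>) - of_real (\<nu> * (\<xi>\<^sup>2 / (1 + b * \<xi>\<^sup>2))) * \<eta>h s \<xi>) (at s within {0..})"
      "((\<lambda>s. ?H \<xi> * uh s \<xi>) has_vector_derivative
        - (\<i> * of_real (coupling a b c d \<xi>)) * \<eta>h s \<xi> - of_real (epsilon_symbol d \<xi>) * (?H \<xi> * uh s \<xi>)) (at s within {0..})"
      if "s \<ge> 0" for s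
    proof -
      obtain \<eta>h' uh' where *: "((\<lambda>s. \<eta>h s \<xi>) has_vector_derivative \<eta>h') (at s within {0..})"
        "((\<lambda>s. uh s \<xi>) has_vector_derivative uh') (at s within {0..})"
        and eq: "let D = \<i> * of_real \<xi> in
                 \<eta>h' + D * uh s \<xi> + of_real a * D ^ 3 * uh s \<xi> - of_real b * D\<^sup>2 * \<eta>h'
                   = of_real \<nu> * D\<^sup>2 * \<eta>h s \<xi> \<and>
                 uh' + D * \<eta>h s \<xi> + of_real c * D ^ 3 * \<eta>h s \<xi> - of_real d * D\<^sup>2 * uh'
                   = D\<^sup>2 * uh s \<xi>"
        using elim \<open>s \<ge> 0\<close> by blast
      have "((\<lambda>s. ?H \<xi> * uh s \<xi>) has_vector_derivative ?H \<xi> * uh') (at s within {0..})"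
        by (rule has_vector_derivative_mult_right[OF *(2)])
      with * eq[unfolded frequency_system_iff[OF C12]]
      show "((\<lambda>s. \<eta>h s \<xi>) has_vector_derivative
        - (\<i> * of_real (coupling a b c d \<xi>)) * (?H \<xi> * uh s \<xi>) - of_real (\<nu> * (\<xi>\<^sup>2 / (1 + b * \<xi>\<^sup>2))) * \<eta>h s \<xi>) (at s within {0..})"
      "((\<lambda>s. ?H \<xi> * uh s \<xi>) has_vector_derivative
        - (\<i> * of_real (coupling a b c d \<xi>)) * \<eta>h s \<xi> - of_real (epsilon_symbol d \<xi>) * (?H \<xi> * uh s \<xi>)) (at s within {0..})"
        by (simp_all only:)
    qed
    have "\<eta>h 0 \<xi> = fourier \<eta>0 \<xi>" "?H \<xi> * uh 0 \<xi> = fourier w0 \<xi>" using elim by auto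
    with damped_system_decay[OF d r(1,2,3) t] show ?case by (simp only:)
  qed
  with L2 show ?thesis by blast
qed

theorem theorem3p9:
  fixes a b c d \<nu> :: real
    and \<eta>0 w0 uh0 :: "real \<Rightarrow> complex"
  assumes C0: "cond_C0 a b c d"
    and C12: "cond_C1 a b c d \<or> cond_C2 a b c d"
    and nu: "\<nu> \<in> {0, 1}"
    and ord: "\<nu> = 1 \<or>
      (\<nu> = 0 \<and> growth_order (sigma_symbol a b c d) > - 2 + 1 / 2 * growth_order (epsilon_symbol d))"
    and eta0: "integrable lborel \<eta>0" "square_integrable \<eta>0"
    and w0: "integrable lborel w0" "square_integrable w0"
    and uh0: "uh0 \<in> borel_measurable lborel"
    and Hu0: "AE \<xi> in lborel. fourier w0 \<xi> = of_real (H_symbol a b c d \<xi>) * uh0 \<xi>"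
  shows "(\<exists>\<eta> w uh. linear_solution \<nu> a b c d \<eta>0 uh0 \<eta> w uh) \<and>
    (\<exists>C::real. \<forall>\<eta> w uh. linear_solution \<nu> a b c d \<eta>0 uh0 \<eta> w uh \<longrightarrow>
       (\<forall>t>0. L2_norm_pair (\<eta> t) (w t) \<le> C * t powr (- 1 / 4)))"
proof
  have "0 \<le> \<nu>" using nu by auto
  then show "\<exists>\<eta> w uh. linear_solution \<nu> a b c d \<eta>0 uh0 \<eta> w uh"
    by (rule linear_solution_exists[OF C12 _ eta0 w0 Hu0])
  from dissipation_rate_lower_bound[OF C12 ord] obtain k q where k: "k > 0"
    and rate: "\<And>\<xi>. k * flat_distance q \<xi> \<le> epsilon_symbol d \<xi>"
      "\<And>\<xi>. k * flat_distance q \<xi> \<le> \<nu> * (\<xi>\<^sup>2 / (1 + b * \<xi>\<^sup>2)) \<or>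
       \<nu> * (\<xi>\<^sup>2 / (1 + b * \<xi>\<^sup>2)) = 0 \<and> k * flat_distance q \<xi> * epsilon_symbol d \<xi> \<le> (coupling a b c d \<xi>)\<^sup>2"
    by blast
  have rate0: "0 \<le> k * flat_distance q \<xi>" for \<xi> using k by (simp add: flat_distance_bounds)
  define g where "g \<xi> = (cmod (fourier \<eta>0 \<xi>))\<^sup>2 + (cmod (fourier w0 \<xi>))\<^sup>2" for \<xi>
  define M where "M = (LINT x|lborel. cmod (\<eta>0 x))\<^sup>2 + (LINT x|lborel. cmod (w0 x))\<^sup>2"
  have g: "integrable lborel g" "\<And>\<xi>. 0 \<le> g \<xi>" "\<And>\<xi>. g \<xi> \<le> M"
  proof -
    show "integrable lborel g"
      using Plancherel(1)[OF eta0] Plancherel(1)[OF w0] by (simp add: g_def[abs_def] square_integrable_def)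
    show "g \<xi> \<le> M" for \<xi>
      unfolding g_def M_def by (intro add_mono power_mono cmod_fourier_le norm_ge_zero)
  qed (simp add: g_def)
  define K where "K = 2 * (((LINT \<xi>|lborel. g \<xi>) + 3 * M * sqrt pi) / sqrt (k / 4))"
  have "0 \<le> M" by (simp add: M_def)
  moreover have "0 \<le> (LINT \<xi>|lborel. g \<xi>)" using g(2) by (simp add: integral_nonneg_AE)
  ultimately have K0: "0 \<le> K" using k by (simp add: K_def)
  have "L2_norm_pair (\<eta> t) (w t) \<le> sqrt K * t powr (- 1 / 4)"
    if sol: "linear_solution \<nu> a b c d \<eta>0 uh0 \<eta> w uh" and t: "t > 0" for \<eta> w uh t
  proof (rule power2_le_imp_le)
    from linear_solution_pointwise_decay[OF C12 rate0 rate Hu0 sol, of t] t obtain f h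
      where fh: "has_fourier_L2 (\<eta> t) f" "has_fourier_L2 (w t) h"
        and bound: "AE \<xi> in lborel. (cmod (f \<xi>))\<^sup>2 + (cmod (h \<xi>))\<^sup>2
           \<le> 2 * exp (- (k * flat_distance q \<xi> / 4) * t) * g \<xi>"
      unfolding g_def by auto
    have fh2: "integrable lborel (\<lambda>\<xi>. (cmod (f \<xi>))\<^sup>2)" "integrable lborel (\<lambda>\<xi>. (cmod (h \<xi>))\<^sup>2)"
      using fh by (auto simp: has_fourier_L2_def square_integrable_def)
    define s where "s = k / 4 * t"
    have s: "s > 0" using k t by (simp add: s_def)
    have es: "2 * exp (- (k * flat_distance q \<xi> / 4) * t) * g \<xi> = 2 * (exp (- s * flat_distance q \<xi>) * g \<xi>)" for \<xi>
      by (simp add: s_def mult_ac)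
    note decay = flat_distance_decay[OF g s, of q]
    have "2 * pi * (L2_norm_pair (\<eta> t) (w t))\<^sup>2 = (L2_norm f)\<^sup>2 + (L2_norm h)\<^sup>2"
      unfolding has_fourier_L2_norm[OF fh(1)] has_fourier_L2_norm[OF fh(2)] L2_norm_pair_def
      by (simp add: power_mult_distrib distrib_left)
    also have "\<dots> = (LINT \<xi>|lborel. (cmod (f \<xi>))\<^sup>2 + (cmod (h \<xi>))\<^sup>2)"
      using fh2 by (simp add: L2_norm_sq)
    also have "\<dots> \<le> (LINT \<xi>|lborel. 2 * (exp (- s * flat_distance q \<xi>) * g \<xi>))"
      using fh2 decay(1) bound unfolding es by (intro integral_mono_AE) auto
    also have "\<dots> = 2 * (LINT \<xi>|lborel. exp (- s * flat_distance q \<xi>) * g \<xi>)"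
      by (rule integral_mult_right_zero)
    also have "\<dots> \<le> 2 * (((LINT \<xi>|lborel. g \<xi>) + 3 * M * sqrt pi) / sqrt s)"
      using decay(2) by (rule mult_left_mono) simp
    also have "\<dots> = K * t powr (- 1 / 2)"
    proof -
      have "sqrt s = sqrt (k / 4) * sqrt t" unfolding s_def by (rule real_sqrt_mult)
      moreover have "t powr (- 1 / 2) = 1 / sqrt t"
        using t powr_minus_divide[of t "1 / 2"] by (simp add: powr_half_sqrt)
      ultimately show ?thesis by (simp only: K_def) simp
    qed
    finally have "2 * pi * (L2_norm_pair (\<eta> t) (w t))\<^sup>2 \<le> K * t powr (- 1 / 2)" .
    (* The factor from Plancherel's theorem exceeds 1. *)
    moreover have "1 * (L2_norm_pair (\<eta> t) (w t))\<^sup>2 \<le> 2 * pi * (L2_norm_pair (\<eta> t) (w t))\<^sup>2"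
      using pi_gt3 by (intro mult_right_mono) auto
    moreover have "K * t powr (- 1 / 2) = (sqrt K * t powr (- 1 / 4))\<^sup>2"
      using K0 t by (simp add: power_mult_distrib power2_eq_square[of "t powr _"] powr_add[symmetric])
    ultimately show "(L2_norm_pair (\<eta> t) (w t))\<^sup>2 \<le> (sqrt K * t powr (- 1 / 4))\<^sup>2" by linarith
  qed (use K0 in simp)
  then show "\<exists>C::real. \<forall>\<eta> w uh. linear_solution \<nu> a b c d \<eta>0 uh0 \<eta> w uh \<longrightarrow>
       (\<forall>t>0. L2_norm_pair (\<eta> t) (w t) \<le> C * t powr (- 1 / 4))" by blast
qed

end
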